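(* Let $k$ be a field and let $\mathcal{H}$ be a $d$-uniform properly-connected hypergraph. Then $\mathcal{I}(\mathcal{H})$ has linear first syzygies if and only if $\operatorname{diam}(\mathcal{H})\le d$.
   Context: A simple hypergraph $\mathcal{H}=(\mathcal{X},\mathcal{E})$ consists of a finite set $\mathcal{X}=\{x_1,\dots,x_n\}$ of vertices and a family $\mathcal{E}$ of distinct subsets (edges) with $|E|\ge 2$ for all edges and no edge contained in a different edge; all hypergraphs are simple. Let $R=k[x_1,\dots,x_n]$, $x^E=\prod_{x\in E}x$, and $\mathcal{I}(\mathcal{H})=(x^E: E\in\mathcal{E})\subseteq R$ (edge ideal), with graded Betti numbers $\beta_{i,j}$ over $R$. For $d$-uniform $\mathcal{H}$, $\mathcal{I}(\mathcal{H})$ has linear first syzygies if $\beta_{1,j}(\mathcal{I}(\mathcal{H}))=0$ for all $j\ne d+1$. $\mathcal{H}$ is $d$-uniform if all edges have cardinality $d$. A chain of length $n$ is a sequence $(E_0,x_1,E_1,\dots,x_n,E_n)$ with $x_1,\dots,x_n$ distinct vertices, $E_0,\dots,E_n$ distinct edges, $x_1\in E_0$, $x_n\in E_n$, and $x_k,x_{k+1}\in E_k$ for $1\le k\le n-1$. In a $d$-uniform hypergraph it is proper if $|E_i\cap E_{i+1}|=d-1$ for all $i$, and a proper chain is irredundant if no proper subsequence is a proper chain from $E_0$ to $E_n$. $\operatorname{dist}_{\mathcal{H}}(E,E')$ is the minimum length of a proper irredundant chain from $E$ to $E'$ ($\infty$ if none exists). A $d$-uniform hypergraph is properly-connected if $\operatorname{dist}_{\mathcal{H}}(E,E')=d-|E\cap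 E'|$ for all edges $E,E'$ with $E\cap E'\neq\emptyset$. The edge diameter is $\operatorname{diam}(\mathcal{H})=\max\{\operatorname{dist}_{\mathcal{H}}(E,H): E,H\in\mathcal{E}\}$ (infinite if two edges are not connected by a proper chain); so $\operatorname{diam}(\mathcal{H})\le d$ means $\operatorname{dist}_{\mathcal{H}}(E,H)\le d$ for all edges $E,H$. *)

theory Defs
  imports
    "HOL-Library.Poly_Mapping"
    "HOL-Library.Extended_Nat"
    "HOL-Library.Sublist"
    "Jordan_Normal_Form.Matrix_Kernel"
begin

section \<open>Hypergraphs\<close>

text \<open>The vertex set is the universe of a finite type \<open>'v\<close>, so a hypergraph is given by its
  set of edges. Vertices lying on no edge are allowed.\<close>

definition simple_hypergraph :: "'v::finite set set \<Rightarrow> bool" where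
  "simple_hypergraph H \<longleftrightarrow>
     (\<forall>E\<in>H. card E \<ge> 2) \<and> (\<forall>E\<in>H. \<forall>F\<in>H. E \<subseteq> F \<longrightarrow> E = F)"

definition uniform :: "nat \<Rightarrow> 'v::finite set set \<Rightarrow> bool" where
  "uniform d H \<longleftrightarrow> (\<forall>E\<in>H. card E = d)"

text \<open>A chain \<open>(E\<^sub>0, x\<^sub>1, E\<^sub>1, \<dots>, x\<^sub>n, E\<^sub>n)\<close> is represented by the list \<open>Es\<close> of
  its edges and the list \<open>xs\<close> of its vertices: \<open>E\<^sub>k\<close> is \<open>Es ! k\<close>, while \<open>x\<^sub>k\<close> is
  \<open>xs ! (k - 1)\<close>. Its length is \<open>length xs\<close>; the chain \<open>(E\<^sub>0)\<close> of length \<open>0\<close> is allowed.\<close>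

definition chain :: "'v::finite set set \<Rightarrow> 'v set list \<Rightarrow> 'v list \<Rightarrow> bool" where
  "chain H Es xs \<longleftrightarrow>
     length Es = length xs + 1 \<and> distinct Es \<and> distinct xs \<and> set Es \<subseteq> H \<and>
     (xs \<noteq> [] \<longrightarrow> hd xs \<in> hd Es \<and> last xs \<in> last Es) \<and>
     (\<forall>k. 1 \<le> k \<and> k < length xs \<longrightarrow> xs ! (k - 1) \<in> Es ! k \<and> xs ! k \<in> Es ! k)"

definition proper_chain :: "nat \<Rightarrow> 'v::finite set set \<Rightarrow> 'v set list \<Rightarrow> 'v list \<Rightarrow> bool" where
  "proper_chain d H Es xs \<longleftrightarrow>
     chain H Es xs \<and> (\<forall>i. i + 1 < length Es \<longrightarrow> card (Es ! i \<inter> Es ! (i + 1)) = d - 1)"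

text \<open>The sequence \<open>E\<^sub>0, x\<^sub>1, E\<^sub>1, \<dots>, x\<^sub>n, E\<^sub>n\<close> itself, needed to speak about its
  subsequences.\<close>

fun chain_seq :: "'v set list \<Rightarrow> 'v list \<Rightarrow> ('v set + 'v) list" where
  "chain_seq (E # Es) (x # xs) = Inl E # Inr x # chain_seq Es xs"
| "chain_seq Es [] = map Inl Es"
| "chain_seq [] xs = map Inr xs"

definition irredundant_chain :: "nat \<Rightarrow> 'v::finite set set \<Rightarrow> 'v set list \<Rightarrow> 'v list \<Rightarrow> bool" where
  "irredundant_chain d H Es xs \<longleftrightarrow>
     proper_chain d H Es xs \<and>
     \<not> (\<exists>Fs ys. proper_chain d H Fs ys \<and> hd Fs = hd Es \<and> last Fs = last Es \<and>
          strict_subseq (chain_seq Fs ys) (chain_seq Es xs))"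

text \<open>The infimum of the empty set is \<open>\<infinity>\<close>.\<close>

definition edge_dist :: "nat \<Rightarrow> 'v::finite set set \<Rightarrow> 'v set \<Rightarrow> 'v set \<Rightarrow> enat" where
  "edge_dist d H E F =
     Inf {enat (length xs) | Es xs. irredundant_chain d H Es xs \<and> hd Es = E \<and> last Es = F}"

definition properly_connected :: "nat \<Rightarrow> 'v::finite set set \<Rightarrow> bool" where
  "properly_connected d H \<longleftrightarrow>
     (\<forall>E\<in>H. \<forall>F\<in>H. E \<inter> F \<noteq> {} \<longrightarrow> edge_dist d H E F = enat (d - card (E \<inter> F)))"

text \<open>The supremum is a maximum unless there are no edges, in which case it is \<open>0\<close>.\<close>

definition edge_diam :: "nat \<Rightarrow> 'v::finite set set \<Rightarrow> enat" where
  "edge_diam d H = Sup {edge_dist d H E F | E F. E \<in> H \<and> F \<in> H}"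


section \<open>Edge ideals and graded Betti numbers\<close>

text \<open>The polynomial ring \<open>k[x\<^sub>v : v \<in> 'v]\<close>, with monomials as exponent vectors.\<close>

type_synonym ('v, 'k) mpoly = "('v \<Rightarrow>\<^sub>0 nat) \<Rightarrow>\<^sub>0 'k"

definition var :: "'v \<Rightarrow> ('v, 'k::field) mpoly" where
  "var v = Poly_Mapping.single (Poly_Mapping.single v 1) 1"

definition edge_ideal :: "'v::finite set set \<Rightarrow> ('v, 'k::field) mpoly set" where
  "edge_ideal H = Modules.module.span (*) {\<Prod>v\<in>E. var v | E. E \<in> H}"

definition mdeg :: "('v::finite \<Rightarrow>\<^sub>0 nat) \<Rightarrow> nat" where
  "mdeg m = (\<Sum>v\<in>UNIV. Poly_Mapping.lookup m v)"

text \<open>A minimal graded free resolution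
  \<open>\<cdots> \<longrightarrow> F\<^sub>2 \<longrightarrow> F\<^sub>1 \<longrightarrow> F\<^sub>0 \<longrightarrow> I \<longrightarrow> 0\<close>
  of an ideal \<open>I\<close> of the polynomial ring \<open>R\<close>. The matrix of \<open>F\<^bsub>i+1\<^esub> \<longrightarrow> F\<^sub>i\<close> is
  \<open>\<phi> (Suc i)\<close>, and \<open>\<phi> 0\<close>, with a single row, is the matrix of \<open>F\<^sub>0 \<longrightarrow> I \<subseteq> R\<close>; so \<open>F\<^sub>i\<close> is
  free of rank \<open>dim_col (\<phi> i)\<close>, which may be \<open>0\<close>. The \<open>q\<close>-th basis element of \<open>F\<^sub>i\<close> has
  degree \<open>a i q\<close>, that is, \<open>F\<^sub>i\<close> is the direct sum of the \<open>R(- a i q)\<close>. The conditions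
  on \<open>mdeg\<close> say that all maps are homogeneous of degree \<open>0\<close>: the entry of \<open>\<phi> (Suc i)\<close> at
  \<open>(p, q)\<close> is homogeneous of degree \<open>a (Suc i) q - a i p\<close>, and zero if this is negative.
  The last condition says that \<open>F\<^bsub>i+1\<^esub>\<close> is mapped into \<open>\<mm> F\<^sub>i\<close>, where \<open>\<mm>\<close> is the ideal
  generated by the variables. Natural numbers suffice as degrees, since each basis element of
  a minimal resolution is mapped to a nonzero element.\<close>

definition minimal_graded_free_resolution ::
  "('v::finite, 'k::field) mpoly set \<Rightarrow> (nat \<Rightarrow> ('v, 'k) mpoly mat) \<Rightarrow> (nat \<Rightarrow> nat \<Rightarrow> nat) \<Rightarrow> bool"
where
  "minimal_graded_free_resolution I \<phi> a \<longleftrightarrow>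
     dim_row (\<phi> 0) = 1 \<and>
     (\<forall>i. dim_row (\<phi> (Suc i)) = dim_col (\<phi> i)) \<and>
     I = {(\<phi> 0 *\<^sub>v w) $ 0 | w. w \<in> carrier_vec (dim_col (\<phi> 0))} \<and>
     (\<forall>i. mat_kernel (\<phi> i) = {\<phi> (Suc i) *\<^sub>v w | w. w \<in> carrier_vec (dim_col (\<phi> (Suc i)))}) \<and>
     (\<forall>q < dim_col (\<phi> 0). \<forall>m \<in> Poly_Mapping.keys (\<phi> 0 $$ (0, q)). mdeg m = a 0 q) \<and>
     (\<forall>i. \<forall>p < dim_row (\<phi> (Suc i)). \<forall>q < dim_col (\<phi> (Suc i)).
        \<forall>m \<in> Poly_Mapping.keys (\<phi> (Suc i) $$ (p, q)). mdeg m + a i p = a (Suc i) q) \<and>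
     (\<forall>i. \<forall>p < dim_row (\<phi> (Suc i)). \<forall>q < dim_col (\<phi> (Suc i)).
        Poly_Mapping.lookup (\<phi> (Suc i) $$ (p, q)) 0 = 0)"

text \<open>\<open>\<beta>\<^bsub>i,j\<^esub>(I)\<close> is the number of basis elements of degree \<open>j\<close> of \<open>F\<^sub>i\<close>. For a homogeneous
  ideal a minimal graded free resolution exists and is unique up to isomorphism, so the choice
  does not matter.\<close>

definition graded_betti :: "('v::finite, 'k::field) mpoly set \<Rightarrow> nat \<Rightarrow> nat \<Rightarrow> nat" where
  "graded_betti I i j =
     (case (SOME (\<phi>, a). minimal_graded_free_resolution I \<phi> a) of
        (\<phi>, a) \<Rightarrow> card {q. q < dim_col (\<phi> i) \<and> a i q = j})"

definition linear_first_syzygies :: "nat \<Rightarrow> ('v::finite, 'k::field) mpoly set \<Rightarrow> bool" where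
  "linear_first_syzygies d I \<longleftrightarrow> (\<forall>j. j \<noteq> d + 1 \<longrightarrow> graded_betti I 1 j = 0)"

end

theory Submission
  imports Defs "HOL-Library.Function_Algebras"
begin

text \<open>Write \<open>x^E\<close> for the product of the variables in \<open>E\<close> and \<open>e\<^sub>E\<close> for the basis vectors of the
free module on the edges. The relation between two generators \<open>x^E\<close> and \<open>x^F\<close> is
\<open>x^(F - E) e\<^sub>E = x^(E - F) e\<^sub>F\<close>, and it is linear exactly if \<open>E\<close> and \<open>F\<close> share
\<open>d - 1\<close> vertices, that is, if they can be consecutive in a proper chain. Such relations
between pairs generate all relations. The theorem therefore asks when the relations between
consecutive edges generate the others, and the grading by exponent vectors confines this
question to the edges inside a union \<open>E \<union> F\<close>.

Suppose that the diameter is at most \<open>d\<close>. Then any two edges \<open>E\<close> and \<open>F\<close> are joined by a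
proper chain of length at most \<open>d - card (E \<inter> F)\<close>. As \<open>E\<close> lacks that many vertices of
\<open>F\<close>, and a step gains at most one of them, each step of the chain has to gain one, so the
chain never leaves \<open>E \<union> F\<close> (\<open>shortest_chain_within_union\<close>). Summing the linear
relations along the chain gives the relation between \<open>x^E\<close> and \<open>x^F\<close>
(\<open>syzygy_linear_induct\<close>).

Suppose conversely that the linear syzygies generate. Intersecting edges have distance less
than or equal to \<open>d\<close> by proper connectedness, so let \<open>E\<close> and \<open>F\<close> be disjoint. Some linear
syzygy must have a variable \<open>v \<in> F\<close> in its coefficient at \<open>e\<^sub>E\<close>, because
\<open>x^F e\<^sub>E - x^E e\<^sub>F\<close> is a combination of linear syzygies. Comparing coefficients of
\<open>x\<^sub>v x^E\<close> then yields an edge \<open>G \<noteq> E\<close> inside \<open>E \<union> {v}\<close>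
(\<open>linear_imp_neighbour\<close>). It meets \<open>F\<close> in the single vertex \<open>v\<close>, hence has distance
\<open>d - 1\<close> from \<open>F\<close>, and \<open>E\<close> can be prepended to a chain from \<open>G\<close> to \<open>F\<close>
(\<open>edge_dist_disjoint_le\<close>).

It remains to connect this with Betti numbers, which are read off from some minimal graded free
resolution. Such a resolution exists (\<open>minimal_resolution_exists\<close>): all maps can be chosen
homogeneous for the grading by exponent vectors, with basis elements in squarefree degrees,
and then the kernel of a map is determined by finitely many finite-dimensional vector spaces,
one for each set of variables, in which minimal generators can be selected. For an arbitrary
minimal resolution, an argument in the style of Nakayama's lemma shows that generators of a
module that is generated in degree \<open>D\<close> have degree \<open>D\<close>
(\<open>constant_coef_of_graded_preimage\<close>, \<open>constant_coef_of_column_preimage\<close>). Consequently its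
first map differs from the row of the monomials \<open>x^E\<close> only by an invertible matrix of
scalars (\<open>to_edges\<close>, \<open>from_edges\<close>), and syzygies can be carried back and forth.\<close>

section \<open>Squarefree monomials, degrees and coefficients\<close>

abbreviation coef :: "('a \<Rightarrow>\<^sub>0 'b::zero) \<Rightarrow> 'a \<Rightarrow> 'b" where "coef \<equiv> Poly_Mapping.lookup"
abbreviation supp :: "('a \<Rightarrow>\<^sub>0 'b::zero) \<Rightarrow> 'a set" where "supp \<equiv> Poly_Mapping.keys"
abbreviation monomial :: "('v \<Rightarrow>\<^sub>0 nat) \<Rightarrow> 'k \<Rightarrow> ('v, 'k::field) mpoly" where "monomial \<equiv> Poly_Mapping.single"

text \<open>The exponent vector of \<open>x^S\<close>.\<close>

definition expo :: "'v::finite set \<Rightarrow> 'v \<Rightarrow>\<^sub>0 nat" where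
  "expo S = (\<Sum>v\<in>S. Poly_Mapping.single v 1)"

lemma coef_expo: "coef (expo S) v = (if v \<in> S then 1 else 0)"
  by (simp add: expo_def lookup_sum lookup_single when_def)

lemma supp_expo [simp]: "supp (expo S) = S"
  by (auto simp: in_keys_iff coef_expo split: if_splits)

lemma expo_inject [simp]: "expo S = expo T \<longleftrightarrow> S = T"
  by (metis supp_expo)

lemma mdeg_add [simp]: "mdeg (a + b) = mdeg a + mdeg b"
  by (simp add: mdeg_def lookup_add sum.distrib)

lemma mdeg_expo [simp]: "mdeg (expo S) = card S"
  by (simp add: mdeg_def coef_expo sum.If_cases)

lemma mdeg_eq_0_iff: "mdeg m = 0 \<longleftrightarrow> m = 0"
  by (auto simp: mdeg_def intro: poly_mapping_eqI)

lemma diff_expo_add: "S \<subseteq> supp m \<Longrightarrow> m - expo S + expo S = m"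
  by (rule poly_mapping_eqI) (auto simp: lookup_add coef_expo lookup_minus in_keys_iff subset_iff)

lemma supp_add: "supp (a + b) = supp a \<union> supp (b :: 'v \<Rightarrow>\<^sub>0 nat)"
  by (auto simp: in_keys_iff lookup_add)

lemma prod_var: "(\<Prod>v\<in>E. var v) = (monomial (expo E) 1 :: ('v::finite,'k::field) mpoly)"
  using finite[of E]
proof (induction E rule: finite_induct)
  case (insert x F)
  then show ?case
    by (simp only: prod.insert[OF insert(1,2)] expo_def sum.insert[OF insert(1,2)] var_def mult_single mult_1)
qed (simp add: expo_def)

lemma coef_single_mult:
  fixes p :: "('v, 'k::field) mpoly"
  shows "coef (monomial a c * p) (a + u) = c * coef p u"
proof -
  have "coef (monomial a c * p) (a + u) =
      Sum_any (\<lambda>k. (c when a = k) * Sum_any (\<lambda>q. coef p q when a + u = k + q))"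
    by (simp add: lookup_mult lookup_single)
  also have "\<dots> = Sum_any (\<lambda>k. c * coef p u when k = a)"
  proof (rule Sum_any.cong)
    fix k
    have "Sum_any (\<lambda>q. coef p q when a + u = a + q) = Sum_any (\<lambda>q. coef p q when q = u)"
      by (rule Sum_any.cong) (auto simp: when_def)
    then show "(c when a = k) * Sum_any (\<lambda>q. coef p q when a + u = k + q) = (c * coef p u when k = a)"
      by (cases "k = a") auto
  qed
  finally show ?thesis by (simp only: Sum_any_when_equal)
qed

lemma coef_single_mult_eq_0:
  fixes p :: "('v, 'k::field) mpoly"
  assumes "\<nexists>u. m = a + u"
  shows "coef (monomial a c * p) m = 0"
proof (rule ccontr)
  assume "coef (monomial a c * p) m \<noteq> 0"
  then have "m \<in> supp (monomial a c * p)" by (simp add: in_keys_iff)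
  then obtain k u where "k \<in> supp (monomial a c)" "m = k + u"
    using keys_mult[of "monomial a c" p] by blast
  then show False using assms by (cases "c = 0") (simp, metis keys_single singletonD)
qed

lemma coef_expo_mult:
  fixes p :: "('v::finite, 'k::field) mpoly"
  shows "coef (monomial (expo S) c * p) m = (if S \<subseteq> supp m then c * coef p (m - expo S) else 0)"
proof (cases "S \<subseteq> supp m")
  case True
  then show ?thesis
    using coef_single_mult[of "expo S" c p "m - expo S"] diff_expo_add[OF True] by (metis add.commute)
next
  case False
  then have "\<nexists>u. m = expo S + u" by (auto simp: supp_add)
  then show ?thesis using False coef_single_mult_eq_0 by metis
qed

definition homog :: "nat \<Rightarrow> ('v::finite, 'k::field) mpoly \<Rightarrow> bool" where
  "homog d p \<longleftrightarrow> (\<forall>m\<in>supp p. mdeg m = d)"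

text \<open>If no exponent of \<open>p\<close> properly divides \<open>m\<close>, then only the constant term of \<open>q\<close> can
contribute to the coefficient of \<open>m\<close> in \<open>p * q\<close>. This is used for \<open>m = 0\<close> and for
homogeneous \<open>p\<close> whose degree is that of \<open>m\<close>.\<close>

lemma coef_mult_indecomposable:
  fixes p q :: "('v::finite, 'k::field) mpoly"
  assumes "\<And>k l. k \<in> supp p \<Longrightarrow> m = k + l \<Longrightarrow> l = 0"
  shows "coef (p * q) m = coef p m * coef q 0"
proof -
  have "coef (p * q) m = Sum_any (\<lambda>k. coef p k * Sum_any (\<lambda>l. coef q l when m = k + l))"
    by (simp add: lookup_mult)
  also have "\<dots> = Sum_any (\<lambda>k. coef p k * coef q 0 when k = m)"
  proof (rule Sum_any.cong)
    fix k
    show "coef p k * Sum_any (\<lambda>l. coef q l when m = k + l) = (coef p k * coef q 0 when k = m)"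
    proof (cases "k \<in> supp p")
      case True
      then have "m = k + l \<longleftrightarrow> l = 0 \<and> k = m" for l
        using assms[of k l] by auto
      then have "Sum_any (\<lambda>l. coef q l when m = k + l) = Sum_any (\<lambda>l. (coef q l when k = m) when l = 0)"
        by (intro Sum_any.cong) (simp add: when_def)
      then show ?thesis by (simp add: mult_when)
    qed (simp add: in_keys_iff)
  qed
  finally show ?thesis by (simp only: Sum_any_when_equal)
qed

lemma coef_zero_mult:
  fixes p q :: "('v::finite, 'k::field) mpoly"
  shows "coef (p * q) 0 = coef p 0 * coef q 0"
proof (rule coef_mult_indecomposable)
  fix k l :: "'v \<Rightarrow>\<^sub>0 nat"
  assume "0 = k + l"
  then have "mdeg k + mdeg l = 0" by (metis mdeg_add mdeg_eq_0_iff)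
  then show "l = 0" by (simp add: mdeg_eq_0_iff)
qed

lemma coef_homog_mult:
  fixes p q :: "('v::finite, 'k::field) mpoly"
  assumes "homog d p" "mdeg m = d"
  shows "coef (p * q) m = coef p m * coef q 0"
proof (rule coef_mult_indecomposable)
  fix k l
  assume "k \<in> supp p" "m = k + l"
  then have "mdeg l = 0" using assms by (auto simp: homog_def)
  then show "l = 0" by (simp add: mdeg_eq_0_iff)
qed

lemma mdeg_eq_1E:
  assumes "mdeg m = 1" obtains v where "m = expo {v}"
proof -
  have "m \<noteq> 0" using assms mdeg_eq_0_iff[of m] by auto
  then obtain v where v: "v \<in> supp m" by (metis all_not_in_conv keys_eq_empty)
  then have m: "m - expo {v} + expo {v} = m" by (intro diff_expo_add) simp
  then have "mdeg (m - expo {v}) + 1 = mdeg m" using mdeg_add[of "m - expo {v}" "expo {v}"] by simp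
  then have "m - expo {v} = 0" using assms by (simp add: mdeg_eq_0_iff)
  then have "m = expo {v}" using m by simp
  then show thesis by (rule that)
qed

abbreviation scalar :: "'k::field \<Rightarrow> ('v, 'k) mpoly" where "scalar c \<equiv> monomial 0 c"

lemma coef_scalar_mult:
  fixes p :: "('v, 'k::field) mpoly"
  shows "coef (scalar c * p) m = c * coef p m" "coef (p * scalar c) m = coef p m * c"
  using coef_single_mult[of 0 c p m] by (simp_all add: mult.commute)

lemma scalar_sum: "(scalar (\<Sum>i\<in>I. c i) :: ('v, 'k::field) mpoly) = (\<Sum>i\<in>I. scalar (c i))"
  by (rule poly_mapping_eqI) (simp add: lookup_sum lookup_single when_def)

section \<open>Maps given by monomial matrices\<close>

text \<open>A homomorphism of free modules that respects the grading by exponent vectors, with basis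
elements in squarefree degrees: the rows have degrees \<open>B p\<close>, the columns have degrees
\<open>A q\<close>, and all information is in the matrix \<open>C\<close> over the field. The entry is only
meaningful if \<open>B p \<subseteq> A q\<close> or \<open>C p q = 0\<close>.\<close>

definition mono_mat :: "nat \<Rightarrow> (nat \<Rightarrow> 'v::finite set) \<Rightarrow> nat \<Rightarrow> (nat \<Rightarrow> 'v set) \<Rightarrow> (nat \<Rightarrow> nat \<Rightarrow> 'k::field)
    \<Rightarrow> ('v, 'k) mpoly mat" where
  "mono_mat nr B nc A C = mat nr nc (\<lambda>(p, q). monomial (expo (A q - B p)) (C p q))"

text \<open>The multigraded component of \<open>W\<close> in degree \<open>m\<close>, for basis elements of degrees \<open>A p\<close>,
identified with a vector over the field: its entry at \<open>p\<close> is the coefficient of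
\<open>x^(m - A p)\<close>, which is zero by convention if \<open>A p\<close> does not divide \<open>m\<close>.\<close>

definition component :: "(nat \<Rightarrow> 'v::finite set) \<Rightarrow> ('v, 'k::field) mpoly vec \<Rightarrow> ('v \<Rightarrow>\<^sub>0 nat) \<Rightarrow> nat \<Rightarrow> 'k" where
  "component A W m p = (if p < dim_vec W \<and> A p \<subseteq> supp m then coef (W $ p) (m - expo (A p)) else 0)"

text \<open>The component of the kernel in a degree with support \<open>S\<close>. It depends on the degree only
through \<open>S\<close>, as a squarefree monomial divides \<open>m\<close> if and only if its variables lie in the
support of \<open>m\<close>; this is why finitely many vector spaces describe the kernel.\<close>

definition strand :: "nat \<Rightarrow> nat \<Rightarrow> (nat \<Rightarrow> 'v set) \<Rightarrow> (nat \<Rightarrow> nat \<Rightarrow> 'k::field) \<Rightarrow> 'v set \<Rightarrow> (nat \<Rightarrow> 'k) set" where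
  "strand nr nc A C S =
     {w. (\<forall>p. w p \<noteq> 0 \<longrightarrow> p < nc \<and> A p \<subseteq> S) \<and> (\<forall>r<nr. (\<Sum>p<nc. C r p * w p) = 0)}"

text \<open>No column is a combination of columns whose degrees divide its own: a linear relation in degree
\<open>S\<close> has no constant entry, that is, none at a column of degree exactly \<open>S\<close>. In a resolution
this makes the entries of the next map lie in the ideal generated by the variables.\<close>

definition irredundant_cols :: "nat \<Rightarrow> nat \<Rightarrow> (nat \<Rightarrow> 'v set) \<Rightarrow> (nat \<Rightarrow> nat \<Rightarrow> 'k::field) \<Rightarrow> bool" where
  "irredundant_cols nr nc A C \<longleftrightarrow> (\<forall>S. \<forall>w \<in> strand nr nc A C S. \<forall>p. A p = S \<longrightarrow> w p = 0)"

lemma irredundant_colsD: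
  "irredundant_cols nr nc A C \<Longrightarrow> w \<in> strand nr nc A C (A p) \<Longrightarrow> w p = 0"
  by (simp add: irredundant_cols_def)

definition generates_strands :: "nat \<Rightarrow> nat \<Rightarrow> (nat \<Rightarrow> 'v set) \<Rightarrow> (nat \<Rightarrow> nat \<Rightarrow> 'k::field) \<Rightarrow>
    nat \<Rightarrow> (nat \<Rightarrow> 'v set) \<Rightarrow> (nat \<Rightarrow> nat \<Rightarrow> 'k) \<Rightarrow> bool" where
  "generates_strands nr nc A C n' A' C' \<longleftrightarrow>
     (\<forall>q<n'. (\<lambda>p. C' p q) \<in> strand nr nc A C (A' q)) \<and>
     (\<forall>S. \<forall>w \<in> strand nr nc A C S.
        \<exists>u. (\<forall>q. u q \<noteq> 0 \<longrightarrow> q < n' \<and> A' q \<subseteq> S) \<and> w = (\<lambda>p. \<Sum>q<n'. C' p q * u q))"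

text \<open>Multigraded maps act on components by their matrices of scalars.\<close>

lemma mono_mat_mult_coef:
  fixes C :: "nat \<Rightarrow> nat \<Rightarrow> 'k::field"
  assumes le: "\<And>p q. p < nr \<Longrightarrow> q < nc \<Longrightarrow> C p q \<noteq> 0 \<Longrightarrow> B p \<subseteq> A q"
    and W: "W \<in> carrier_vec nc" and r: "r < nr"
  shows "coef ((mono_mat nr B nc A C *\<^sub>v W) $ r) u = (\<Sum>p<nc. C r p * component A W (u + expo (B r)) p)"
proof -
  have "(mono_mat nr B nc A C *\<^sub>v W) $ r = (\<Sum>p<nc. monomial (expo (A p - B r)) (C r p) * W $ p)"
    using W r by (simp add: mono_mat_def scalar_prod_def atLeast0LessThan)
  then have "coef ((mono_mat nr B nc A C *\<^sub>v W) $ r) u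
      = (\<Sum>p<nc. coef (monomial (expo (A p - B r)) (C r p) * W $ p) u)"
    by (simp add: lookup_sum)
  also have "\<dots> = (\<Sum>p<nc. C r p * component A W (u + expo (B r)) p)"
  proof (rule sum.cong)
    fix p assume p: "p \<in> {..<nc}"
    show "coef (monomial (expo (A p - B r)) (C r p) * W $ p) u = C r p * component A W (u + expo (B r)) p"
    proof (cases "C r p = 0")
      case False
      then have BA: "B r \<subseteq> A p" using le r p by auto
      have "u - expo (A p - B r) = u + expo (B r) - expo (A p)"
        by (rule poly_mapping_eqI) (use BA in \<open>auto simp: lookup_add lookup_minus coef_expo\<close>)
      moreover have "A p - B r \<subseteq> supp u \<longleftrightarrow> A p \<subseteq> supp (u + expo (B r))"
        by (auto simp: supp_add)
      ultimately show ?thesis using p W by (simp add: coef_expo_mult component_def)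
    qed simp
  qed simp
  finally show ?thesis .
qed

lemma component_mono_mat_mult:
  fixes C :: "nat \<Rightarrow> nat \<Rightarrow> 'k::field"
  assumes le: "\<And>p q. p < nr \<Longrightarrow> q < nc \<Longrightarrow> C p q \<noteq> 0 \<Longrightarrow> B p \<subseteq> A q"
    and W: "W \<in> carrier_vec nc" and r: "r < nr"
  shows "component B (mono_mat nr B nc A C *\<^sub>v W) m r = (\<Sum>p<nc. C r p * component A W m p)"
proof (cases "B r \<subseteq> supp m")
  case True
  have "coef ((mono_mat nr B nc A C *\<^sub>v W) $ r) (m - expo (B r)) = (\<Sum>p<nc. C r p * component A W m p)"
    using mono_mat_mult_coef[OF le W r, where u="m - expo (B r)"] True by (simp add: diff_expo_add)
  then show ?thesis using r True by (simp add: component_def[of B] mono_mat_def)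
next
  case False
  have "C r p * component A W m p = 0" if "p < nc" for p
    using le[OF r that] False by (auto simp: component_def)
  then have "(\<Sum>p<nc. C r p * component A W m p) = 0" by (simp add: sum.neutral)
  then show ?thesis using False by (simp add: component_def[of B])
qed

lemma poly_vec_eqI:
  fixes V W :: "('v::finite, 'k::field) mpoly vec"
  assumes "dim_vec V = dim_vec W" "\<And>m p. p < dim_vec V \<Longrightarrow> component A V m p = component A W m p"
  shows "V = W"
proof (rule eq_vecI)
  fix p assume p: "p < dim_vec W"
  show "V $ p = W $ p"
  proof (rule poly_mapping_eqI)
    fix u
    show "coef (V $ p) u = coef (W $ p) u"
      using assms(2)[of p "u + expo (A p)"] p assms(1) by (simp add: component_def supp_add)
  qed
qed (use assms in simp)

lemma mono_mat_kernel_iff: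
  fixes C :: "nat \<Rightarrow> nat \<Rightarrow> 'k::field"
  assumes le: "\<And>p q. p < nr \<Longrightarrow> q < nc \<Longrightarrow> C p q \<noteq> 0 \<Longrightarrow> B p \<subseteq> A q"
    and W: "W \<in> carrier_vec nc"
  shows "W \<in> mat_kernel (mono_mat nr B nc A C) \<longleftrightarrow> (\<forall>m. component A W m \<in> strand nr nc A C (supp m))"
proof -
  let ?M = "mono_mat nr B nc A C"
  have dim: "dim_row ?M = nr" "dim_col ?M = nc" by (simp_all add: mono_mat_def)
  have "W \<in> mat_kernel ?M \<longleftrightarrow> ?M *\<^sub>v W = 0\<^sub>v nr"
    using W by (simp add: mat_kernel_def dim)
  also have "\<dots> \<longleftrightarrow> (\<forall>r<nr. \<forall>m. component B (?M *\<^sub>v W) m r = 0)"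
  proof
    assume R: "\<forall>r<nr. \<forall>m. component B (?M *\<^sub>v W) m r = 0"
    show "?M *\<^sub>v W = 0\<^sub>v nr"
      by (rule poly_vec_eqI[where A=B]) (use R dim in \<open>auto simp: component_def[of B "0\<^sub>v nr"]\<close>)
  qed (simp add: component_def)
  also have "\<dots> \<longleftrightarrow> (\<forall>r<nr. \<forall>m. (\<Sum>p<nc. C r p * component A W m p) = 0)"
    using component_mono_mat_mult[OF le W] by simp
  also have "\<dots> \<longleftrightarrow> (\<forall>m. component A W m \<in> strand nr nc A C (supp m))"
    using W by (auto simp: strand_def component_def[of A W])
  finally show ?thesis .
qed

text \<open>Exactness can be tested in each multidegree, where it is a statement about vectors over the
field.\<close>

lemma mono_mat_exact:
  fixes C C' :: "nat \<Rightarrow> nat \<Rightarrow> 'k::field"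
  assumes le: "\<And>p q. p < nr \<Longrightarrow> q < nc \<Longrightarrow> C p q \<noteq> 0 \<Longrightarrow> B p \<subseteq> A q"
    and gen: "generates_strands nr nc A C n' A' C'"
  shows "mat_kernel (mono_mat nr B nc A C) = {mono_mat nc A n' A' C' *\<^sub>v w |w. w \<in> carrier_vec n'}"
proof -
  let ?M = "mono_mat nr B nc A C" and ?N = "mono_mat nc A n' A' C'"
  have col: "(\<lambda>p. C' p q) \<in> strand nr nc A C (A' q)" if "q < n'" for q
    using gen that by (simp add: generates_strands_def)
  have le': "A p \<subseteq> A' q" if "p < nc" "q < n'" "C' p q \<noteq> 0" for p q
    using col[OF that(2)] that by (auto simp: strand_def)
  have "?N *\<^sub>v U \<in> mat_kernel ?M" if U: "U \<in> carrier_vec n'" for U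
  proof -
    have N: "?N *\<^sub>v U \<in> carrier_vec nc" by (simp add: mono_mat_def carrier_vecI)
    have "component A (?N *\<^sub>v U) m \<in> strand nr nc A C (supp m)" for m
    proof -
      have "(\<Sum>p<nc. C r p * component A (?N *\<^sub>v U) m p) = 0" if "r < nr" for r
      proof -
        have "(\<Sum>p<nc. C r p * component A (?N *\<^sub>v U) m p)
            = (\<Sum>p<nc. \<Sum>q<n'. C r p * C' p q * component A' U m q)"
          using component_mono_mat_mult[OF le' U] by (simp add: sum_distrib_left mult.assoc)
        also have "\<dots> = (\<Sum>q<n'. (\<Sum>p<nc. C r p * C' p q) * component A' U m q)"
          by (subst sum.swap) (simp add: sum_distrib_right)
        also have "\<dots> = 0"
          using col that by (simp add: strand_def)
        finally show ?thesis .
      qed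
      moreover have "p < nc \<and> A p \<subseteq> supp m" if "component A (?N *\<^sub>v U) m p \<noteq> 0" for p
        using that carrier_vecD[OF N] by (cases "p < nc \<and> A p \<subseteq> supp m") (simp_all only: component_def if_False simp_thms)
      ultimately show ?thesis by (simp add: strand_def)
    qed
    then show ?thesis using mono_mat_kernel_iff[OF le N] by simp
  qed
  moreover have "\<exists>U \<in> carrier_vec n'. W = ?N *\<^sub>v U" if "W \<in> mat_kernel ?M" for W
  proof -
    have W: "W \<in> carrier_vec nc" using that by (simp add: mat_kernel_def mono_mat_def)
    then have strand: "component A W m \<in> strand nr nc A C (supp m)" for m
      using that mono_mat_kernel_iff[OF le W] by simp
    (* The zero component gets the zero preimage, so that the chosen preimages of all
       components assemble to polynomials. *)
    define P where "P m u \<longleftrightarrow> (\<forall>q. u q \<noteq> 0 \<longrightarrow> q < n' \<and> A' q \<subseteq> supp m) \<and>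
        component A W m = (\<lambda>p. \<Sum>q<n'. C' p q * u q) \<and> (component A W m = (\<lambda>_. 0) \<longrightarrow> u = (\<lambda>_. 0))"
      for m and u :: "nat \<Rightarrow> 'k"
    have ex: "\<exists>u. P m u" for m
    proof (cases "component A W m = (\<lambda>_. 0)")
      case True
      then have "P m (\<lambda>_. 0)" by (simp add: P_def)
      then show ?thesis by blast
    next
      case False
      obtain u where "\<forall>q. u q \<noteq> 0 \<longrightarrow> q < n' \<and> A' q \<subseteq> supp m" "component A W m = (\<lambda>p. \<Sum>q<n'. C' p q * u q)"
        using gen strand[of m] unfolding generates_strands_def by blast
      then have "P m u" using False unfolding P_def by blast
      then show ?thesis by blast
    qed
    obtain u where u: "\<And>m. P m (u m)"
      using choice[of P] ex by blast
    (* Reading each component back at the degrees of the columns yields the preimage of W. *)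
    define U where "U = vec n' (\<lambda>q. Abs_poly_mapping (\<lambda>t. u (t + expo (A' q)) q))"
    have U: "U \<in> carrier_vec n'" by (simp add: U_def)
    have "finite {t. u (t + expo (A' q)) q \<noteq> 0}" for q
    proof (rule finite_subset)
      show "{t. u (t + expo (A' q)) q \<noteq> 0} \<subseteq>
          (\<lambda>m. m - expo (A' q)) ` (\<Union>p<nc. (\<lambda>k. k + expo (A p)) ` supp (W $ p))"
      proof
        fix t assume "t \<in> {t. u (t + expo (A' q)) q \<noteq> 0}"
        then have "u (t + expo (A' q)) q \<noteq> 0" by simp
        then have "component A W (t + expo (A' q)) \<noteq> (\<lambda>_. 0)"
          using u[of "t + expo (A' q)"] unfolding P_def by metis
        then obtain p where "component A W (t + expo (A' q)) p \<noteq> 0" by auto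
        then have p: "p < nc" "A p \<subseteq> supp (t + expo (A' q))" "t + expo (A' q) - expo (A p) \<in> supp (W $ p)"
          using W by (auto simp: component_def in_keys_iff split: if_splits)
        then have "t + expo (A' q) \<in> (\<lambda>k. k + expo (A p)) ` supp (W $ p)"
          by (intro image_eqI[where x="t + expo (A' q) - expo (A p)"]) (simp_all add: diff_expo_add)
        then show "t \<in> (\<lambda>m. m - expo (A' q)) ` (\<Union>p<nc. (\<lambda>k. k + expo (A p)) ` supp (W $ p))"
          using p(1) by (intro image_eqI[where x="t + expo (A' q)"]) auto
      qed
    qed auto
    then have coef_U: "coef (U $ q) t = u (t + expo (A' q)) q" if "q < n'" for q t
      using that by (simp add: U_def)
    have "component A' U m q = u m q" for m q
    proof -
      have "u m q = 0" if "\<not> (q < n' \<and> A' q \<subseteq> supp m)" using that u[of m] unfolding P_def by blast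
      then show ?thesis using coef_U U by (auto simp: component_def diff_expo_add)
    qed
    moreover have "component A W m = (\<lambda>p. \<Sum>q<n'. C' p q * u m q)" for m
      using u[of m] unfolding P_def by blast
    ultimately have "component A (?N *\<^sub>v U) m p = component A W m p" if "p < nc" for m p
      using component_mono_mat_mult[OF le' U that] by simp
    then have "?N *\<^sub>v U = W"
      using W by (intro poly_vec_eqI[where A=A]) (auto simp: mono_mat_def)
    then show ?thesis using U by auto
  qed
  ultimately show ?thesis by blast
qed

section \<open>Minimal generators of multigraded kernels\<close>

lemma (in vector_space) subspace_of_finite_span_basis:
  assumes "finite T" "V \<subseteq> span T"
  obtains B where "finite B" "B \<subseteq> V" "V \<subseteq> span B"
proof -
  obtain B where "B \<subseteq> V" "independent B" "V \<subseteq> span B"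
    using maximal_independent_subset by blast
  then show thesis
    using independent_span_bound[OF assms(1), of B] assms(2) that by blast
qed

lemma sum_fun_apply: "(\<Sum>i\<in>I. f i) x = (\<Sum>i\<in>I. f i x :: 'a::comm_monoid_add)"
  by (induction I rule: infinite_finite_induct) auto

text \<open>Among all finite families of homogeneous kernel elements that generate every strand, one of
minimal cardinality works: if some generator occurred with a nonzero constant coefficient in a
relation, it could be expressed by generators whose degrees divide its own and be left out.
Finite families exist because each of the finitely many strands is finite-dimensional.\<close>

lemma minimal_strand_generators_exist:
  fixes C :: "nat \<Rightarrow> nat \<Rightarrow> 'k::field" and A :: "nat \<Rightarrow> 'v::finite set"
  shows "\<exists>n' A' C'. generates_strands nr nc A C n' A' C' \<and> irredundant_cols nc n' A' C'"
proof -
  interpret fv: vector_space "\<lambda>(c::'k) (f::nat \<Rightarrow> 'k) x. c * f x"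
    by standard (auto simp: algebra_simps fun_eq_iff)
  let ?K = "strand nr nc A C"
  define upto where "upto G S = {w :: nat \<Rightarrow> 'k. \<exists>T\<subseteq>S. (T, w) \<in> G}" for G and S :: "'v set"
  define gens where "gens G \<longleftrightarrow> finite G \<and> (\<forall>(S, w) \<in> G. w \<in> ?K S) \<and> (\<forall>S. ?K S \<subseteq> fv.span (upto G S))" for G
  have "\<exists>B. finite B \<and> B \<subseteq> ?K S \<and> ?K S \<subseteq> fv.span B" for S
  proof -
    define e where "e p = (\<lambda>x::nat. if x = p then 1 else 0 :: 'k)" for p
    have "?K S \<subseteq> fv.span (e ` {..<nc})"
    proof
      fix w assume w: "w \<in> ?K S"
      have "w = (\<Sum>p<nc. (\<lambda>x. w p * e p x))"
      proof
        fix x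
        have "(\<Sum>p<nc. (\<lambda>x. w p * e p x)) x = (\<Sum>p<nc. if p = x then w p else 0)"
          unfolding sum_fun_apply by (rule sum.cong) (auto simp: e_def)
        also have "\<dots> = w x" using w by (auto simp: strand_def)
        finally show "w x = (\<Sum>p<nc. (\<lambda>x. w p * e p x)) x" ..
      qed
      also have "\<dots> \<in> fv.span (e ` {..<nc})"
        by (intro fv.span_sum fv.span_scale fv.span_base) auto
      finally show "w \<in> fv.span (e ` {..<nc})" .
    qed
    then obtain B where "finite B" "B \<subseteq> ?K S" "?K S \<subseteq> fv.span B"
      by (rule fv.subspace_of_finite_span_basis[OF finite_imageI[OF finite_lessThan]])
    then show ?thesis by (intro exI conjI)
  qed
  then have "\<exists>Bs. \<forall>S. finite (Bs S) \<and> Bs S \<subseteq> ?K S \<and> ?K S \<subseteq> fv.span (Bs S)"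
    by (intro choice allI)
  then obtain Bs where Bs: "\<And>S. finite (Bs S)" "\<And>S. Bs S \<subseteq> ?K S" "\<And>S. ?K S \<subseteq> fv.span (Bs S)"
    by blast
  have "gens (Sigma UNIV Bs)"
    unfolding gens_def
  proof (intro conjI allI)
    fix S
    have "Bs S \<subseteq> upto (Sigma UNIV Bs) S" by (auto simp: upto_def)
    then show "?K S \<subseteq> fv.span (upto (Sigma UNIV Bs) S)"
      using Bs(3)[of S] fv.span_mono by blast
  qed (use Bs in auto)
  then obtain G where G: "gens G" and min: "\<And>G'. gens G' \<Longrightarrow> card G \<le> card G'"
    using ex_has_least_nat[of gens _ card] by blast
  define n' where "n' = card G"
  have "finite G" using G by (simp add: gens_def)
  then obtain h where h: "bij_betw h {..<n'} G"
    using ex_bij_betw_nat_finite[of G] by (auto simp: n'_def atLeast0LessThan)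
  define A' where "A' q = fst (h q)" for q
  define C' where "C' p q = snd (h q) p" for p q
  have hG: "h q \<in> G" if "q < n'" for q using h that by (auto simp: bij_betw_def)
  have col: "snd (h q) \<in> ?K (A' q)" if "q < n'" for q
    using G hG[OF that] by (auto simp: gens_def A'_def)
  have "\<exists>u. (\<forall>q. u q \<noteq> 0 \<longrightarrow> q < n' \<and> A' q \<subseteq> S) \<and> w = (\<lambda>p. \<Sum>q<n'. C' p q * u q)" if w: "w \<in> ?K S" for S w
  proof -
    define V where "V = {w. \<exists>u. (\<forall>q. u q \<noteq> 0 \<longrightarrow> q < n' \<and> A' q \<subseteq> S) \<and> w = (\<lambda>p. \<Sum>q<n'. C' p q * u q)}"
    have "fv.subspace V"
    proof (rule fv.subspaceI)
      show "0 \<in> V" by (auto simp: V_def fun_eq_iff intro!: exI[of _ "\<lambda>_. 0"])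
    next
      fix x y assume "x \<in> V" "y \<in> V"
      then obtain u u' where "\<forall>q. u q \<noteq> 0 \<longrightarrow> q < n' \<and> A' q \<subseteq> S" "x = (\<lambda>p. \<Sum>q<n'. C' p q * u q)"
        "\<forall>q. u' q \<noteq> 0 \<longrightarrow> q < n' \<and> A' q \<subseteq> S" "y = (\<lambda>p. \<Sum>q<n'. C' p q * u' q)"
        by (auto simp: V_def)
      moreover from this have "u q + u' q \<noteq> 0 \<longrightarrow> q < n' \<and> A' q \<subseteq> S" for q
        by (metis add.right_neutral)
      ultimately show "x + y \<in> V" unfolding V_def
        by (intro CollectI exI[of _ "\<lambda>q. u q + u' q"]) (simp add: fun_eq_iff distrib_left sum.distrib)
    next
      fix c x assume "x \<in> V"
      then obtain u where "\<forall>q. u q \<noteq> 0 \<longrightarrow> q < n' \<and> A' q \<subseteq> S" "x = (\<lambda>p. \<Sum>q<n'. C' p q * u q)"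
        by (auto simp: V_def)
      then show "(\<lambda>p. c * x p) \<in> V" unfolding V_def
        by (intro CollectI exI[of _ "\<lambda>q. c * u q"]) (auto simp: fun_eq_iff sum_distrib_left mult_ac)
    qed
    moreover have "upto G S \<subseteq> V"
    proof
      fix v assume "v \<in> upto G S"
      then obtain T where T: "T \<subseteq> S" "(T, v) \<in> G" by (auto simp: upto_def)
      then obtain q where q: "q < n'" "h q = (T, v)" using h by (auto simp: bij_betw_def)
      have "v = (\<lambda>p. \<Sum>q'<n'. C' p q' * (if q' = q then 1 else 0))"
        using q by (auto simp: C'_def if_distrib cong: if_cong)
      then show "v \<in> V" unfolding V_def using q T
        by (intro CollectI exI[of _ "\<lambda>q'. if q' = q then 1 else 0"]) (auto simp: A'_def)
    qed
    ultimately have "fv.span (upto G S) \<subseteq> V" by (rule fv.span_minimal[rotated])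
    then have "w \<in> V" using w G by (auto simp: gens_def)
    then show ?thesis by (simp add: V_def)
  qed
  then have "generates_strands nr nc A C n' A' C'"
    using col by (simp add: generates_strands_def C'_def)
  moreover have "irredundant_cols nc n' A' C'"
    unfolding irredundant_cols_def
  proof (intro allI ballI impI, rule ccontr)
    fix S u q
    assume u: "u \<in> strand nc n' A' C' S" and q: "A' q = S" "u q \<noteq> 0"
    have u': "q' < n' \<and> A' q' \<subseteq> S" if "u q' \<noteq> 0" for q' using u that by (simp add: strand_def)
    then have qn: "q < n'" using q by simp
    let ?G = "G - {h q}"
    (* Solve the relation u for the generator number q. *)
    have "snd (h q) = (\<Sum>q'\<in>{..<n'} - {q}. (\<lambda>p. (- u q' / u q) * snd (h q') p))"
    proof
      fix p
      have "(\<Sum>q'<n'. C' p q' * u q') = 0"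
      proof (cases "p < nc")
        case False
        then have "C' p q' = 0" if "q' < n'" for q'
          using col[OF that] by (auto simp: strand_def C'_def)
        then show ?thesis by simp
      qed (use u in \<open>simp add: strand_def\<close>)
      then have "C' p q * u q + (\<Sum>q'\<in>{..<n'} - {q}. C' p q' * u q') = 0"
        using qn by (simp add: sum.remove)
      then have "C' p q = - (\<Sum>q'\<in>{..<n'} - {q}. C' p q' * u q') / u q"
        using q(2) by (simp add: field_simps add_eq_0_iff)
      also have "\<dots> = (\<Sum>q'\<in>{..<n'} - {q}. (- u q' / u q) * C' p q')"
        by (simp add: sum_divide_distrib sum_negf mult.commute)
      finally show "snd (h q) p = (\<Sum>q'\<in>{..<n'} - {q}. (\<lambda>p. (- u q' / u q) * snd (h q') p)) p"
        by (simp add: C'_def sum_fun_apply)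
    qed
    also have "\<dots> \<in> fv.span (upto ?G S)"
    proof (rule fv.span_sum)
      fix q' assume q': "q' \<in> {..<n'} - {q}"
      show "(\<lambda>p. (- u q' / u q) * snd (h q') p) \<in> fv.span (upto ?G S)"
      proof (cases "u q' = 0")
        case True
        then show ?thesis using fv.span_zero by (simp add: zero_fun_def)
      next
        case False
        have "h q' \<noteq> h q" using h q' qn by (auto simp: bij_betw_def inj_on_def)
        then have "snd (h q') \<in> upto ?G S"
          using u'[OF False] hG[of q'] unfolding upto_def A'_def
          by (intro CollectI exI[of _ "fst (h q')"]) auto
        then show ?thesis by (intro fv.span_scale fv.span_base)
      qed
    qed
    finally have hq: "snd (h q) \<in> fv.span (upto ?G S)" .
    have span: "?K S' \<subseteq> fv.span (upto ?G S')" for S'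
    proof -
      have "upto G S' \<subseteq> fv.span (upto ?G S')"
      proof
        fix w assume "w \<in> upto G S'"
        then obtain T where T: "T \<subseteq> S'" "(T, w) \<in> G" by (auto simp: upto_def)
        show "w \<in> fv.span (upto ?G S')"
        proof (cases "(T, w) = h q")
          case True
          from True[symmetric] have "fst (h q) = T" "snd (h q) = w" by simp_all
          then have "T = S" "w = snd (h q)" using q(1) unfolding A'_def by blast+
          moreover from this have "upto ?G S \<subseteq> upto ?G S'" using T(1) unfolding upto_def by blast
          ultimately show ?thesis using hq fv.span_mono by blast
        next
          case False
          then show ?thesis using T by (intro fv.span_base) (auto simp: upto_def)
        qed
      qed
      then have "fv.span (upto G S') \<subseteq> fv.span (upto ?G S')"
        using fv.span_minimal fv.subspace_span by blast
      moreover have "?K S' \<subseteq> fv.span (upto G S')" using G unfolding gens_def by blast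
      ultimately show ?thesis by (rule subset_trans[rotated])
    qed
    have "gens ?G"
      using G span unfolding gens_def by blast
    then have "card G \<le> card ?G" by (rule min)
    moreover have "card ?G < card G" using hG[OF qn] \<open>finite G\<close> by (rule card_Diff1_less[rotated])
    ultimately show False by simp
  qed
  ultimately show ?thesis by blast
qed

section \<open>Existence of a minimal free resolution of an edge ideal\<close>

text \<open>Membership in the span of the finite set of edge monomials, with coefficients indexed by
the edges rather than by the monomials.\<close>

lemma in_edge_ideal_iff:
  fixes H :: "'v::finite set set" and x :: "('v, 'k::field) mpoly"
  shows "x \<in> edge_ideal H \<longleftrightarrow> (\<exists>c. x = (\<Sum>E\<in>H. c E * monomial (expo E) 1))"
proof -
  interpret R: Modules.module "(*) :: ('v, 'k) mpoly \<Rightarrow> _"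
    by standard (simp_all add: algebra_simps)
  let ?t = "\<lambda>E. monomial (expo E) 1 :: ('v, 'k) mpoly"
  have inj: "inj_on ?t H"
    by (rule inj_onI) (metis keys_single expo_inject one_neq_zero singleton_inject)
  have "{\<Prod>v\<in>E. var v :: ('v, 'k) mpoly |E. E \<in> H} = ?t ` H"
    by (auto simp: prod_var)
  then have "edge_ideal H = range (\<lambda>u. \<Sum>y\<in>?t ` H. u y * y)"
    by (simp add: edge_ideal_def R.span_finite)
  then have "x \<in> edge_ideal H \<longleftrightarrow> (\<exists>u. x = (\<Sum>y\<in>?t ` H. u y * y))" by auto
  also have "\<dots> \<longleftrightarrow> (\<exists>u. x = (\<Sum>E\<in>H. u (?t E) * ?t E))"
    using inj by (simp add: sum.reindex)
  also have "\<dots> \<longleftrightarrow> (\<exists>c. x = (\<Sum>E\<in>H. c E * ?t E))"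
  proof
    assume "\<exists>c. x = (\<Sum>E\<in>H. c E * ?t E)"
    then obtain c where "x = (\<Sum>E\<in>H. c E * ?t E)" ..
    also have "\<dots> = (\<Sum>E\<in>H. c (inv_into H ?t (?t E)) * ?t E)"
      by (rule sum.cong) (simp_all add: inv_into_f_f[OF inj])
    finally show "\<exists>u. x = (\<Sum>E\<in>H. u (?t E) * ?t E)" by (rule exI[of _ "\<lambda>y. c (inv_into H ?t y)"])
  next
    assume "\<exists>u. x = (\<Sum>E\<in>H. u (?t E) * ?t E)"
    then obtain u where "x = (\<Sum>E\<in>H. u (?t E) * ?t E)" ..
    then show "\<exists>c. x = (\<Sum>E\<in>H. c E * ?t E)" by (rule exI[of _ "\<lambda>E. u (?t E)"])
  qed
  finally show ?thesis .
qed

lemma edge_ideal_eq_image: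
  fixes H :: "'v::finite set set"
  assumes h: "bij_betw h {..<n} H"
  shows "(edge_ideal H :: ('v, 'k::field) mpoly set)
    = {(mono_mat 1 (\<lambda>_. {}) n h (\<lambda>_ _. 1) *\<^sub>v w) $ 0 |w. w \<in> carrier_vec n}"
proof -
  let ?M = "mono_mat 1 (\<lambda>_. {}) n h (\<lambda>_ _. 1 :: 'k)"
  let ?g = "inv_into {..<n} h"
  have g: "?g E < n \<and> h (?g E) = E" if "E \<in> H" for E
    using h that bij_betw_inv_into_right[OF h that] bij_betwE[OF bij_betw_inv_into[OF h]] by auto
  have mult: "(?M *\<^sub>v w) $ 0 = (\<Sum>E\<in>H. w $ ?g E * monomial (expo E) 1)" if "w \<in> carrier_vec n" for w
  proof -
    have "(?M *\<^sub>v w) $ 0 = (\<Sum>q<n. w $ q * monomial (expo (h q)) 1)"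
      using that by (simp add: mono_mat_def scalar_prod_def atLeast0LessThan mult.commute)
    also have "\<dots> = (\<Sum>q<n. w $ ?g (h q) * monomial (expo (h q)) 1)"
      using bij_betw_inv_into_left[OF h] by (intro sum.cong) auto
    also have "\<dots> = (\<Sum>E\<in>H. w $ ?g E * monomial (expo E) 1)"
      by (rule sum.reindex_bij_betw[OF h])
    finally show ?thesis .
  qed
  show ?thesis
  proof (intro equalityI subsetI)
    fix x :: "('v, 'k) mpoly" assume "x \<in> edge_ideal H"
    then obtain c where c: "x = (\<Sum>E\<in>H. c E * monomial (expo E) 1)" by (auto simp: in_edge_ideal_iff)
    have "x = (?M *\<^sub>v vec n (c \<circ> h)) $ 0"
      unfolding c by (subst mult) (auto intro!: sum.cong simp: g)
    then show "x \<in> {(?M *\<^sub>v w) $ 0 |w. w \<in> carrier_vec n}"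
      by (intro CollectI exI[of _ "vec n (c \<circ> h)"]) simp
  next
    fix x assume "x \<in> {(?M *\<^sub>v w) $ 0 |w. w \<in> carrier_vec n}"
    then obtain w where "w \<in> carrier_vec n" "x = (?M *\<^sub>v w) $ 0" by blast
    then have "x = (\<Sum>E\<in>H. w $ ?g E * monomial (expo E) 1)" by (simp only: mult)
    then show "x \<in> edge_ideal H" unfolding in_edge_ideal_iff by (intro exI[of _ "\<lambda>E. w $ ?g E"])
  qed
qed

text \<open>Start with the row of the edge monomials, whose columns are irredundant because no edge
contains another one, and repeatedly append a map given by minimal generators of the kernel.
Irredundancy of one map makes the degrees strictly increase along the nonzero entries of the
next one, so that these entries are not constant.\<close>

lemma minimal_resolution_exists:
  assumes "simple_hypergraph H"
  shows "\<exists>\<phi> a. minimal_graded_free_resolution (edge_ideal H :: ('v::finite, 'k::field) mpoly set) \<phi> a"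
proof -
  define valid :: "nat \<times> (nat \<Rightarrow> 'v set) \<times> nat \<times> (nat \<Rightarrow> 'v set) \<times> (nat \<Rightarrow> nat \<Rightarrow> 'k) \<Rightarrow> bool"
    where "valid = (\<lambda>(nr, B, nc, A, C). (\<forall>p<nr. \<forall>q<nc. C p q \<noteq> 0 \<longrightarrow> B p \<subset> A q) \<and> irredundant_cols nr nc A C)"
  define step :: "nat \<times> (nat \<Rightarrow> 'v set) \<times> nat \<times> (nat \<Rightarrow> 'v set) \<times> (nat \<Rightarrow> nat \<Rightarrow> 'k) \<Rightarrow> _ \<Rightarrow> bool"
    where "step = (\<lambda>(nr, B, nc, A, C) (nr', B', n', A', C'). nr' = nc \<and> B' = A \<and> generates_strands nr nc A C n' A' C')"
  have "finite H" by simp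
  then obtain h where h: "bij_betw h {..<card H} H"
    using ex_bij_betw_nat_finite[of H] by (auto simp: atLeast0LessThan)
  have hH: "h q \<in> H" if "q < card H" for q using h that by (auto simp: bij_betw_def)
  define init where "init = (1::nat, (\<lambda>_. {}) :: nat \<Rightarrow> 'v set, card H, h, (\<lambda>_ _. 1) :: nat \<Rightarrow> nat \<Rightarrow> 'k)"
  have "valid init"
  proof -
    have "irredundant_cols 1 (card H) h (\<lambda>_ _. 1 :: 'k)"
      unfolding irredundant_cols_def
    proof (intro allI ballI impI, rule ccontr)
      fix S w q assume w: "w \<in> strand 1 (card H) h (\<lambda>_ _. 1 :: 'k) S" and q: "h q = S" "w q \<noteq> 0"
      have qn: "q < card H" using w q by (auto simp: strand_def)
      have "w p = 0" if "p < card H" "p \<noteq> q" for p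
      proof (rule ccontr)
        assume "w p \<noteq> 0"
        then have "h p \<subseteq> h q" using w q by (simp add: strand_def)
        then have "h p = h q" using assms hH[OF that(1)] hH[OF qn] by (simp add: simple_hypergraph_def)
        then show False using h that qn by (auto simp: bij_betw_def inj_on_def)
      qed
      then have "(\<Sum>p\<in>{..<card H} - {q}. w p) = 0" by (intro sum.neutral) auto
      then have "(\<Sum>p<card H. w p) = w q" using qn by (simp add: sum.remove)
      moreover have "(\<Sum>p<card H. w p) = 0" using w by (simp add: strand_def)
      ultimately show False using q by simp
    qed
    moreover have "{} \<subset> h q" if "q < card H" for q
      using assms hH[OF that] by (auto simp: simple_hypergraph_def)
    ultimately show ?thesis by (simp add: valid_def init_def)
  qed
  (* The clause for i = 0 pins the first map while the others are chosen. *)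
  have "\<exists>s. \<forall>i. (valid (s i) \<and> (i = 0 \<longrightarrow> s i = init)) \<and> step (s i) (s (Suc i))"
  proof (rule dependent_nat_choice)
    show "\<exists>x. valid x \<and> (0 = (0::nat) \<longrightarrow> x = init)" using \<open>valid init\<close> by blast
  next
    fix x and i :: nat
    assume x: "valid x \<and> (i = 0 \<longrightarrow> x = init)"
    obtain nr B nc A C where xe: "x = (nr, B, nc, A, C)" by (cases x) auto
    obtain n' A' C' where g: "generates_strands nr nc A C n' A' C'" "irredundant_cols nc n' A' C'"
      using minimal_strand_generators_exist by blast
    have "A p \<subset> A' q" if "q < n'" "C' p q \<noteq> 0" for p q
    proof -
      have s: "(\<lambda>p. C' p q) \<in> strand nr nc A C (A' q)" using g(1) that(1) by (simp add: generates_strands_def)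
      then have "A p \<subseteq> A' q" using that by (simp add: strand_def)
      moreover have "irredundant_cols nr nc A C" using x by (simp add: xe valid_def)
      then have "A p \<noteq> A' q"
        using irredundant_colsD[of nr nc A C "\<lambda>p. C' p q" p] s that(2) by auto
      ultimately show ?thesis by blast
    qed
    then have "valid (nc, A, n', A', C') \<and> step x (nc, A, n', A', C')"
      using g by (simp add: valid_def step_def xe)
    then show "\<exists>y. (valid y \<and> (Suc i = 0 \<longrightarrow> y = init)) \<and> step x y" by blast
  qed
  then obtain s where s: "\<And>i. valid (s i)" "s 0 = init" "\<And>i. step (s i) (s (Suc i))" by blast
  define nr where "nr i = fst (s i)" for i
  define B where "B i = fst (snd (s i))" for i
  define nc where "nc i = fst (snd (snd (s i)))" for i
  define A where "A i = fst (snd (snd (snd (s i))))" for i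
  define C where "C i = snd (snd (snd (snd (s i))))" for i
  have s_eq: "s i = (nr i, B i, nc i, A i, C i)" for i
    by (simp add: nr_def B_def nc_def A_def C_def)
  have strict: "B i p \<subset> A i q" if "p < nr i" "q < nc i" "C i p q \<noteq> 0" for i p q
    using s(1)[of i] that by (simp add: s_eq valid_def)
  have nr: "nr (Suc i) = nc i" and BA: "B (Suc i) = A i"
    and gen: "generates_strands (nr i) (nc i) (A i) (C i) (nc (Suc i)) (A (Suc i)) (C (Suc i))" for i
    using s(3)[of i] by (simp_all add: s_eq step_def)
  have init: "nr 0 = 1" "B 0 = (\<lambda>_. {})" "nc 0 = card H" "A 0 = h" "C 0 = (\<lambda>_ _. 1)"
    using s(2) by (simp_all add: s_eq init_def)
  define \<phi> where "\<phi> i = mono_mat (nr i) (B i) (nc i) (A i) (C i)" for i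
  have dim: "dim_row (\<phi> i) = nr i" "dim_col (\<phi> i) = nc i" for i
    by (simp_all add: \<phi>_def mono_mat_def)
  have entry: "\<phi> i $$ (p, q) = monomial (expo (A i q - B i p)) (C i p q)" if "p < nr i" "q < nc i" for i p q
    using that by (simp add: \<phi>_def mono_mat_def)
  have key: "m = expo (A i q - B i p) \<and> B i p \<subset> A i q"
    if "p < nr i" "q < nc i" "m \<in> supp (\<phi> i $$ (p, q))" for i p q m
    using that strict[OF that(1,2)] by (auto simp: entry split: if_splits)
  have "minimal_graded_free_resolution (edge_ideal H :: ('v, 'k) mpoly set) \<phi> (\<lambda>i q. card (A i q))"
    unfolding minimal_graded_free_resolution_def
  proof (intro conjI allI impI ballI)
    show "edge_ideal H = {(\<phi> 0 *\<^sub>v w) $ 0 |w. w \<in> carrier_vec (dim_col (\<phi> 0))}"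
      using edge_ideal_eq_image[OF h, where 'k='k] by (simp add: dim) (simp add: \<phi>_def init)
  next
    fix i
    show "mat_kernel (\<phi> i) = {\<phi> (Suc i) *\<^sub>v w |w. w \<in> carrier_vec (dim_col (\<phi> (Suc i)))}"
      using mono_mat_exact[OF _ gen[of i], where B="B i"] strict[of _ i] by (simp add: dim) (auto simp: \<phi>_def nr BA)
  next
    fix q m assume q: "q < dim_col (\<phi> 0)" "m \<in> supp (\<phi> 0 $$ (0, q))"
    then show "mdeg m = card (A 0 q)" using key[of 0 0 q m] by (simp add: dim init)
  next
    fix i p q m
    assume "p < dim_row (\<phi> (Suc i))" "q < dim_col (\<phi> (Suc i))" "m \<in> supp (\<phi> (Suc i) $$ (p, q))"
    then have "m = expo (A (Suc i) q - A i p)" "A i p \<subset> A (Suc i) q"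
      using key[of p "Suc i" q m] by (simp_all add: dim BA)
    then show "mdeg m + card (A i p) = card (A (Suc i) q)"
      by (simp add: card_Diff_subset card_mono psubset_imp_subset)
  next
    fix i p q
    assume pq: "p < dim_row (\<phi> (Suc i))" "q < dim_col (\<phi> (Suc i))"
    show "coef (\<phi> (Suc i) $$ (p, q)) 0 = 0"
    proof (rule ccontr)
      assume "coef (\<phi> (Suc i) $$ (p, q)) 0 \<noteq> 0"
      then have "0 \<in> supp (\<phi> (Suc i) $$ (p, q))" by (simp add: in_keys_iff)
      then have "0 = expo (A (Suc i) q - A i p)" "A i p \<subset> A (Suc i) q"
        using key[of p "Suc i" q 0] pq by (simp_all add: dim BA)
      then show False by (metis DiffI all_not_in_conv keys_zero psubset_imp_ex_mem supp_expo)
    qed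
  qed (simp_all add: dim init nr)
  then show ?thesis by blast
qed

section \<open>Chains in properly-connected hypergraphs\<close>

lemma length_chain_seq: "length (chain_seq Es xs) = length Es + length xs"
  by (induction Es xs rule: chain_seq.induct) auto

text \<open>The distance is an infimum over irredundant proper chains only. A proper chain of minimal
length between given edges is irredundant, since a proper subsequence that is again a chain
would be shorter.\<close>

lemma edge_dist_le_length:
  assumes "proper_chain d H Es xs"
  shows "edge_dist d H (hd Es) (last Es) \<le> enat (length xs)"
proof -
  let ?P = "\<lambda>(Fs, ys). proper_chain d H Fs ys \<and> hd Fs = hd Es \<and> last Fs = last Es"
  obtain c where c: "?P c" "\<And>c'. ?P c' \<Longrightarrow> length (snd c) \<le> length (snd c')"
    using ex_has_least_nat[of ?P "(Es, xs)" "\<lambda>c. length (snd c)"] assms by auto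
  obtain Fs ys where ce: "c = (Fs, ys)" by (cases c)
  have P: "proper_chain d H Fs ys" "hd Fs = hd Es" "last Fs = last Es" using c(1) by (auto simp: ce)
  have min: "length ys \<le> length zs"
    if "proper_chain d H Gs zs" "hd Gs = hd Es" "last Gs = last Es" for Gs zs
    using c(2)[of "(Gs, zs)"] that by (simp add: ce)
  have "\<not> strict_subseq (chain_seq Gs zs) (chain_seq Fs ys)"
    if G: "proper_chain d H Gs zs" "hd Gs = hd Es" "last Gs = last Es" for Gs zs
  proof
    assume "strict_subseq (chain_seq Gs zs) (chain_seq Fs ys)"
    then have "subseq (chain_seq Gs zs) (chain_seq Fs ys)" "chain_seq Gs zs \<noteq> chain_seq Fs ys"
      by (auto simp: subseq_order.less_le)
    then have "length (chain_seq Gs zs) < length (chain_seq Fs ys)"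
      using list_emb_length subseq_same_length by (metis le_neq_implies_less)
    moreover have "length Gs = length zs + 1" "length Fs = length ys + 1"
      using G(1) P(1) by (simp_all add: proper_chain_def chain_def)
    ultimately show False using min[OF G] by (simp add: length_chain_seq)
  qed
  then have "irredundant_chain d H Fs ys" using P by (auto simp: irredundant_chain_def)
  then have "edge_dist d H (hd Es) (last Es) \<le> enat (length ys)"
    unfolding edge_dist_def using P by (intro Inf_lower) auto
  also have "\<dots> \<le> enat (length xs)" using min[OF assms] by simp
  finally show ?thesis .
qed

lemma proper_chain_of_edge_dist:
  assumes "edge_dist d H E F \<le> enat n"
  obtains Es xs where "proper_chain d H Es xs" "hd Es = E" "last Es = F" "length xs \<le> n"
proof -
  let ?D = "{enat (length xs) |Es xs. irredundant_chain d H Es xs \<and> hd Es = E \<and> last Es = F}"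
  have "?D \<noteq> {}" using assms unfolding edge_dist_def by (metis Inf_enat_def enat_ord_simps(5) infinity_ileE)
  then have "edge_dist d H E F \<in> ?D" unfolding edge_dist_def Inf_enat_def by (metis (no_types, lifting) LeastI_ex all_not_in_conv)
  then obtain Es xs where "irredundant_chain d H Es xs" "hd Es = E" "last Es = F"
      "edge_dist d H E F = enat (length xs)" by auto
  then show thesis using assms by (intro that[of Es xs]) (auto simp: irredundant_chain_def)
qed

text \<open>Consecutive edges differ in one vertex, so a single step of a proper chain picks up at most one
vertex of \<open>F\<close>.\<close>

lemma card_Diff_le_steps:
  assumes "uniform d H" "set Es \<subseteq> H"
    and adj: "\<And>i. i + 1 < length Es \<Longrightarrow> card (Es ! i \<inter> Es ! (i + 1)) = d - 1"
    and "i + n < length Es"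
  shows "card (F - Es ! i) \<le> card (F - Es ! (i + n)) + n"
  using assms(4)
proof (induction n)
  case (Suc n)
  let ?G = "Es ! (i + n)" and ?G' = "Es ! (i + n + 1)"
  have "?G' \<in> H" using Suc.prems assms(2) by (metis add.assoc add_Suc_right add.right_neutral Suc_eq_plus1 nth_mem subsetD)
  then have "card ?G' = d" using assms(1) by (simp add: uniform_def)
  moreover have "card (?G' - ?G) = card ?G' - card (?G \<inter> ?G')"
    by (simp add: card_Diff_subset_Int Int_commute)
  ultimately have "card (?G' - ?G) \<le> 1" using adj[of "i + n"] Suc.prems by simp
  moreover have "card (F - ?G) \<le> card ((F - ?G') \<union> (?G' - ?G))" by (rule card_mono) auto
  moreover have "\<dots> \<le> card (F - ?G') + card (?G' - ?G)" by (rule card_Un_le)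
  ultimately show ?case using Suc by simp
qed simp

text \<open>A chain whose length is the number of vertices of the last edge missing from the first one has
to pick up a vertex of the last edge in every step. It cannot afford a step to any other
vertex.\<close>

lemma shortest_chain_within_union:
  assumes "uniform d H" "set Es \<subseteq> H"
    and adj: "\<And>i. i + 1 < length Es \<Longrightarrow> card (Es ! i \<inter> Es ! (i + 1)) = d - 1"
    and len: "length Es = n + 1" "card (Es ! n - Es ! 0) \<ge> n" and "i \<le> n"
  shows "Es ! i \<subseteq> Es ! 0 \<union> Es ! n"
  using \<open>i \<le> n\<close>
proof (induction i)
  case (Suc i)
  let ?G = "Es ! i" and ?G' = "Es ! (i + 1)" and ?F = "Es ! n"
  have G': "?G' \<in> H" using Suc.prems assms(2) len by (metis Suc_eq_plus1 Suc_le_mono le_imp_less_Suc nth_mem subsetD)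
  then have "card ?G' = d" using assms(1) by (simp add: uniform_def)
  moreover have "card (?G' - ?G) = card ?G' - card (?G \<inter> ?G')"
    by (simp add: card_Diff_subset_Int Int_commute)
  ultimately have one: "card (?G' - ?G) \<le> 1" using adj[of i] Suc.prems len by simp
  have "?G' - ?G \<subseteq> ?F"
  proof (rule ccontr)
    assume "\<not> ?G' - ?G \<subseteq> ?F"
    then obtain y where y: "y \<in> ?G' - ?G" "y \<notin> ?F" by blast
    then have "{y} = ?G' - ?G" using one by (intro card_seteq) auto
    then have "?F - ?G \<subseteq> ?F - ?G'" using y by auto
    then have "card (?F - ?G) \<le> card (?F - ?G')" by (intro card_mono) auto
    also have "\<dots> \<le> card (?F - Es ! (i + 1 + (n - (i + 1)))) + (n - (i + 1))"
      by (rule card_Diff_le_steps[OF assms(1,2) adj]) (use Suc.prems len in auto)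
    finally have "card (?F - ?G) \<le> n - (i + 1)" using Suc.prems by simp
    moreover have "card (?F - Es ! 0) \<le> card (?F - Es ! (0 + i)) + i"
      by (rule card_Diff_le_steps[OF assms(1,2) adj]) (use Suc.prems len in auto)
    ultimately show False using len Suc.prems by simp
  qed
  then show ?case using Suc by auto
qed simp

text \<open>For intersecting edges the length \<open>d - card (E \<inter> F)\<close> comes from proper connectedness;
for disjoint edges it is \<open>d\<close>, which is the bound on the diameter.\<close>

lemma proper_chain_within_union:
  assumes u: "uniform d H" and pc: "properly_connected d H" and diam: "edge_diam d H \<le> enat d"
    and E: "E \<in> H" and F: "F \<in> H"
  obtains Es where "Es \<noteq> []" "hd Es = E" "last Es = F" "set Es \<subseteq> H" "\<Union> (set Es) \<subseteq> E \<union> F"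
    "successively (\<lambda>G G'. card (G \<inter> G') = d - 1) Es"
proof -
  have cE: "card E = d" and cF: "card F = d" using u E F by (simp_all add: uniform_def)
  have "edge_dist d H E F \<le> enat (d - card (E \<inter> F))"
  proof (cases "E \<inter> F = {}")
    case True
    have "edge_dist d H E F \<le> edge_diam d H"
      unfolding edge_diam_def using E F by (intro Sup_upper) blast
    also note diam
    finally show ?thesis using True by simp
  next
    case False
    then show ?thesis using pc E F by (simp add: properly_connected_def)
  qed
  then obtain Es xs where c: "proper_chain d H Es xs" "hd Es = E" "last Es = F"
    and len: "length xs \<le> d - card (E \<inter> F)" by (rule proper_chain_of_edge_dist)
  define n where "n = length xs"
  have Es: "length Es = n + 1" "set Es \<subseteq> H"
    and adj: "\<And>i. i + 1 < length Es \<Longrightarrow> card (Es ! i \<inter> Es ! (i + 1)) = d - 1"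
    using c(1) by (simp_all add: proper_chain_def chain_def n_def)
  then have ne: "Es \<noteq> []" by auto
  have nth: "Es ! 0 = E" "Es ! n = F" using c ne Es by (simp_all add: hd_conv_nth last_conv_nth)
  have "card (F - E) = d - card (E \<inter> F)"
    using cF by (simp add: card_Diff_subset_Int Int_commute)
  then have "Es ! i \<subseteq> E \<union> F" if "i \<le> n" for i
  proof -
    have "n \<le> card (Es ! n - Es ! 0)" unfolding nth using len \<open>card (F - E) = _\<close> by (simp add: n_def)
    from shortest_chain_within_union[OF u Es(2) adj Es(1) this that] show ?thesis by (simp only: nth)
  qed
  then have "\<Union> (set Es) \<subseteq> E \<union> F"
    using Es(1) by (intro Union_least) (metis in_set_conv_nth less_Suc_eq_le Suc_eq_plus1)
  moreover have "successively (\<lambda>G G'. card (G \<inter> G') = d - 1) Es"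
    using adj by (simp add: successively_conv_nth)
  ultimately show thesis using that ne c Es by blast
qed

text \<open>Here \<open>G\<close> shares \<open>d - 1\<close> vertices with \<open>E\<close> and meets \<open>F\<close> in \<open>v\<close> alone. So there is a
chain of length \<open>d - 1\<close> from \<open>G\<close> to \<open>F\<close>, and \<open>E\<close> is prepended to it. A vertex of
\<open>E \<inter> G\<close> that does not occur on the chain is available: the last of the at most
\<open>d - 1\<close> vertices of the chain lies in \<open>F\<close>, hence outside \<open>E\<close>.\<close>

lemma edge_dist_disjoint_le:
  assumes s: "simple_hypergraph H" and u: "uniform d H" and pc: "properly_connected d H"
    and H: "E \<in> H" "F \<in> H" "G \<in> H" and dis: "E \<inter> F = {}" and G: "G \<noteq> E" "G \<subseteq> insert v E" "v \<in> F"
  shows "edge_dist d H E F \<le> enat d"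
proof -
  have c: "card E = d" "card F = d" "card G = d" using u H by (simp_all add: uniform_def)
  have d: "d \<ge> 2" using s H(1) c by (auto simp: simple_hypergraph_def)
  have "v \<in> G"
  proof (rule ccontr)
    assume "v \<notin> G"
    then have "G \<subseteq> E" using G by blast
    then show False using G c by (simp add: card_subset_eq)
  qed
  then have GF: "G \<inter> F = {v}" and GE: "E \<inter> G = G - {v}" using G dis by auto
  then have cEG: "card (E \<inter> G) = d - 1" using c \<open>v \<in> G\<close> by simp
  have "edge_dist d H G F = enat (d - 1)"
    using pc H GF by (simp add: properly_connected_def)
  then obtain Es xs where ch: "proper_chain d H Es xs" "hd Es = G" "last Es = F" "length xs \<le> d - 1"
    using proper_chain_of_edge_dist[of d H G F "d - 1"] by auto
  have len: "length Es = length xs + 1" and dist: "distinct Es" "distinct xs" and sub: "set Es \<subseteq> H"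
    and ends: "xs \<noteq> [] \<Longrightarrow> hd xs \<in> G \<and> last xs \<in> F"
    and mid: "\<And>k. 1 \<le> k \<Longrightarrow> k < length xs \<Longrightarrow> xs ! (k - 1) \<in> Es ! k \<and> xs ! k \<in> Es ! k"
    and adj: "\<And>i. i + 1 < length Es \<Longrightarrow> card (Es ! i \<inter> Es ! (i + 1)) = d - 1"
    using ch by (auto simp: proper_chain_def chain_def)
  then have ne: "Es \<noteq> []" by auto
  then have Es: "Es \<noteq> []" "Es ! 0 = G" "Es ! length xs = F" using ch len
    by (simp_all add: hd_conv_nth last_conv_nth)
  have "G \<noteq> F" using cEG d dis by auto
  then have xs: "xs \<noteq> []" using Es by auto
  (* From E all d vertices of F are missing, too many for the rest of a chain of length d - 1. *)
  have "E \<notin> set Es"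
  proof
    assume "E \<in> set Es"
    then obtain k where k: "k < length Es" "Es ! k = E" by (auto simp: in_set_conv_nth)
    have "card (F - Es ! k) \<le> card (F - Es ! (k + (length xs - k))) + (length xs - k)"
      by (rule card_Diff_le_steps[OF u sub adj]) (use k len in auto)
    then have "card (F - E) \<le> d - 1" using k len Es ch(4) by simp
    moreover have "F - E = F" using dis by blast
    ultimately show False using c d by simp
  qed
  have "set xs \<inter> E \<subseteq> set (butlast xs)"
  proof
    fix y assume y: "y \<in> set xs \<inter> E"
    then have "y \<noteq> last xs" using ends[OF xs] dis by blast
    moreover have "y \<in> set (butlast xs @ [last xs])" using y xs by simp
    ultimately show "y \<in> set (butlast xs)" by auto
  qed
  then have "card (set xs \<inter> E) \<le> card (set (butlast xs))" by (intro card_mono) auto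
  also have "\<dots> \<le> length xs - 1" using card_length[of "butlast xs"] by simp
  also have "\<dots> < card (E \<inter> G)" using ch(4) d cEG by simp
  finally have "\<not> E \<inter> G \<subseteq> set xs \<inter> E"
    using card_mono[of "set xs \<inter> E" "E \<inter> G"] by auto
  then obtain x where x: "x \<in> E" "x \<in> G" "x \<notin> set xs" by blast
  have "(x # xs) ! (k - 1) \<in> (E # Es) ! k \<and> (x # xs) ! k \<in> (E # Es) ! k"
    if k: "1 \<le> k" "k < length (x # xs)" for k
  proof (cases "k = 1")
    case True
    then show ?thesis using x Es xs ends by (simp add: hd_conv_nth)
  next
    case False
    then obtain j where "k = Suc (Suc j)" using k(1) by (cases k; cases "k - 1") auto
    then show ?thesis using mid[of "Suc j"] k by simp
  qed
  moreover have "card ((E # Es) ! i \<inter> (E # Es) ! (i + 1)) = d - 1" if "i + 1 < length (E # Es)" for i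
    using that adj[of "i - 1"] cEG Es by (cases i) auto
  ultimately have "proper_chain d H (E # Es) (x # xs)"
    using len dist sub \<open>E \<notin> set Es\<close> x H(1) ends xs ch(3) Es(1) unfolding proper_chain_def chain_def by simp
  from edge_dist_le_length[OF this] have "edge_dist d H E F \<le> enat (length (x # xs))"
    using Es ch(3) by simp
  also have "\<dots> \<le> enat d" using ch(4) d by simp
  finally show ?thesis .
qed

lemma edge_diam_le_iff: "edge_diam d H \<le> n \<longleftrightarrow> (\<forall>E\<in>H. \<forall>F\<in>H. edge_dist d H E F \<le> n)"
  unfolding edge_diam_def by (auto simp: Sup_le_iff)

section \<open>Degrees in a minimal presentation\<close>

lemma in_supp_sum_multE:
  fixes g w :: "nat \<Rightarrow> ('v, 'k::field) mpoly"
  assumes "m \<in> supp (\<Sum>q<n. g q * w q)"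
  obtains q k l where "q < n" "k \<in> supp (g q)" "l \<in> supp (w q)" "m = k + l"
proof -
  have "\<exists>q<n. coef (g q * w q) m \<noteq> 0"
    using assms by (auto simp: in_keys_iff lookup_sum dest: sum.not_neutral_contains_not_neutral)
  then obtain q where "q < n" "m \<in> supp (g q * w q)" by (auto simp: in_keys_iff)
  then show thesis using keys_mult[of "g q" "w q"] that by blast
qed

text \<open>The key to reading off degrees. Let \<open>g\<close> be a graded matrix with minimal columns, the column
\<open>q\<close> having degree \<open>a q\<close>. If \<open>g\<close> maps \<open>w\<close> to a vector of degree \<open>D\<close>, then the part of
\<open>w\<close> of degree \<open>a q\<close> is mapped to zero for \<open>a q \<noteq> D\<close>, and by minimality the entries
of this part have no constant term. The entry at \<open>q\<close> of this part is the constant term of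
\<open>w q\<close>.\<close>

lemma constant_coef_of_graded_preimage:
  fixes g :: "'p \<Rightarrow> nat \<Rightarrow> ('v::finite, 'k::field) mpoly"
  assumes graded: "\<And>p q m. p \<in> P \<Longrightarrow> q < n \<Longrightarrow> m \<in> supp (g p q) \<Longrightarrow> mdeg m + b p = a q"
    and minimal: "\<And>w q. (\<And>p. p \<in> P \<Longrightarrow> (\<Sum>q<n. g p q * w q) = 0) \<Longrightarrow> q < n \<Longrightarrow> coef (w q) 0 = 0"
    and image: "\<And>p m. p \<in> P \<Longrightarrow> m \<in> supp (\<Sum>q<n. g p q * w q) \<Longrightarrow> mdeg m + b p = D"
    and q: "q < n" "a q \<noteq> D"
  shows "coef (w q) 0 = 0"
proof -
  define e where "e = a q"
  define in_deg where "in_deg q' = Poly_Mapping.mapp (\<lambda>m c. if mdeg m + a q' = e then c else 0) (w q')" for q'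
  define off_deg where "off_deg q' = w q' - in_deg q'" for q'
  have coef_in: "coef (in_deg q') m = (if mdeg m + a q' = e then coef (w q') m else 0)" for q' m
    by (auto simp: in_deg_def lookup_mapp when_def in_keys_iff)
  have "(\<Sum>q<n. g p q * in_deg q) = 0" if p: "p \<in> P" for p
  proof (rule poly_mapping_eqI)
    fix m
    have split: "(\<Sum>q<n. g p q * w q) = (\<Sum>q<n. g p q * in_deg q) + (\<Sum>q<n. g p q * off_deg q)"
      by (simp add: off_deg_def flip: sum.distrib distrib_left)
    show "coef (\<Sum>q<n. g p q * in_deg q) m = coef 0 m"
    proof (cases "mdeg m + b p = e")
      case True
      then have "m \<notin> supp (\<Sum>q<n. g p q * w q)" using image[OF p, of m] q(2) e_def by auto
      moreover have "m \<notin> supp (\<Sum>q<n. g p q * off_deg q)"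
      proof
        assume "m \<in> supp (\<Sum>q<n. g p q * off_deg q)"
        then obtain q' k l where "q' < n" "k \<in> supp (g p q')" "l \<in> supp (off_deg q')" "m = k + l"
          by (rule in_supp_sum_multE)
        moreover from this have "mdeg l + a q' \<noteq> e"
          by (auto simp: in_keys_iff off_deg_def lookup_minus coef_in)
        ultimately show False using graded[OF p, of q' k] True by simp
      qed
      ultimately show ?thesis unfolding split by (simp add: in_keys_iff lookup_add)
    next
      case False
      have "m \<notin> supp (\<Sum>q<n. g p q * in_deg q)"
      proof
        assume "m \<in> supp (\<Sum>q<n. g p q * in_deg q)"
        then obtain q' k l where "q' < n" "k \<in> supp (g p q')" "l \<in> supp (in_deg q')" "m = k + l"
          by (rule in_supp_sum_multE)
        moreover from this have "mdeg l + a q' = e"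
          by (auto simp: in_keys_iff coef_in split: if_splits)
        ultimately show False using graded[OF p, of q' k] False by simp
      qed
      then show ?thesis by (simp add: in_keys_iff)
    qed
  qed
  then have "coef (in_deg q) 0 = 0" using minimal q(1) by blast
  then show ?thesis by (simp add: coef_in e_def mdeg_eq_0_iff)
qed

text \<open>The difference of \<open>w\<close> and the unit vector at \<open>q\<close> is in the kernel, so minimality applies to
it. Together with the previous lemma this excludes that the degree of the column \<open>q\<close> is
different from \<open>D\<close> whenever the image is generated in degree \<open>D\<close>.\<close>

lemma constant_coef_of_column_preimage:
  fixes g :: "'p \<Rightarrow> nat \<Rightarrow> ('v::finite, 'k::field) mpoly"
  assumes minimal: "\<And>w q. (\<And>p. p \<in> P \<Longrightarrow> (\<Sum>q<n. g p q * w q) = 0) \<Longrightarrow> q < n \<Longrightarrow> coef (w q) 0 = 0"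
    and col: "\<And>p. p \<in> P \<Longrightarrow> g p q = (\<Sum>q<n. g p q * w q)" and q: "q < n"
  shows "coef (w q) 0 = 1"
proof -
  define w' where "w' q' = (if q' = q then 1 else 0) - w q'" for q'
  have "(\<Sum>q<n. g p q * w' q) = 0" if "p \<in> P" for p
  proof -
    have "(\<Sum>q'<n. g p q' * w' q') = (\<Sum>q'<n. if q' = q then g p q' else 0) - (\<Sum>q<n. g p q * w q)"
      unfolding sum_subtractf[symmetric] by (rule sum.cong) (auto simp: w'_def algebra_simps)
    then show ?thesis using q col[OF that] by simp
  qed
  then have "coef (w' q) 0 = 0" using minimal[of w'] q by blast
  then show ?thesis by (simp add: w'_def lookup_minus)
qed

section \<open>Syzygies of the edge monomials\<close>

definition is_syzygy :: "'v::finite set set \<Rightarrow> ('v set \<Rightarrow> ('v, 'k::field) mpoly) \<Rightarrow> bool" where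
  "is_syzygy H s \<longleftrightarrow> (\<Sum>E\<in>H. s E * monomial (expo E) 1) = 0"

text \<open>The relation between two edge monomials. Its entries are linear forms when \<open>E\<close> and \<open>F\<close>
are edges of the same cardinality \<open>d\<close> that share \<open>d - 1\<close> vertices.\<close>

definition linear_syzygy :: "'v::finite set \<Rightarrow> 'v set \<Rightarrow> 'v set \<Rightarrow> ('v, 'k::field) mpoly" where
  "linear_syzygy E F = (\<lambda>G. if G = E then monomial (expo (F - E)) 1
     else if G = F then - monomial (expo (E - F)) 1 else 0)"

lemma sum_two_points:
  fixes x y :: "'a::comm_monoid_add"
  assumes "finite A" "a \<in> A" "b \<in> A" "a \<noteq> b"
  shows "(\<Sum>i\<in>A. if i = a then x else if i = b then y else 0) = x + y"
proof -
  have "(\<Sum>i\<in>A. if i = a then x else if i = b then y else 0)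
      = (\<Sum>i\<in>A. (if i = a then x else 0) + (if i = b then y else 0))"
    using assms(4) by (intro sum.cong) auto
  then show ?thesis using assms by (simp add: sum.distrib)
qed

lemma coef_syzygy_sum:
  fixes s :: "'v::finite set \<Rightarrow> ('v, 'k::field) mpoly"
  shows "coef (\<Sum>E\<in>H. s E * monomial (expo E) 1) m
    = (\<Sum>E\<in>H. if E \<subseteq> supp m then coef (s E) (m - expo E) else 0)"
  by (simp add: lookup_sum coef_expo_mult mult.commute[of "s _"] cong: if_cong)

lemma is_syzygy_two_points:
  assumes "E \<in> H" "F \<in> H" "E \<noteq> F" "mE + expo E = mF + expo F"
  shows "is_syzygy H (\<lambda>G. if G = E then monomial mE c else if G = F then - monomial mF c else 0)"
proof -
  have "(\<Sum>G\<in>H. (if G = E then monomial mE c else if G = F then - monomial mF c else 0) * monomial (expo G) 1)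
      = (\<Sum>G\<in>H. if G = E then monomial mE c * monomial (expo E) 1
           else if G = F then - monomial mF c * monomial (expo F) 1 else 0)"
    by (rule sum.cong) auto
  also have "\<dots> = monomial mE c * monomial (expo E) 1 + - monomial mF c * monomial (expo F) 1"
    using assms by (intro sum_two_points) auto
  also have "\<dots> = 0" using assms(4) by (simp add: mult_single)
  finally show ?thesis by (simp add: is_syzygy_def)
qed

text \<open>If a syzygy of the edge monomials has a term at \<open>E\<close>, in multidegree \<open>m\<close>, then it also has
one at another edge \<open>F\<close> in the same multidegree, since the coefficients in this degree add up
to zero. Subtracting a multiple of the relation between \<open>E\<close> and \<open>F\<close> removes the term at
\<open>E\<close> and creates no new terms. That relation telescopes along the sequence of edges from
\<open>E\<close> to \<open>F\<close>, whose members divide \<open>m\<close> because they lie in \<open>E \<union> F\<close>.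
So everything that holds for the linear syzygies and is inherited by combinations holds for all
syzygies.\<close>

lemma syzygy_linear_induct [consumes 1, case_names zero add mult linear]:
  fixes s :: "'v::finite set \<Rightarrow> ('v, 'k::field) mpoly"
  assumes s: "is_syzygy H s"
    and links: "\<And>E F. E \<in> H \<Longrightarrow> F \<in> H \<Longrightarrow> \<exists>Es. Es \<noteq> [] \<and> hd Es = E \<and> last Es = F \<and> set Es \<subseteq> H \<and>
      \<Union> (set Es) \<subseteq> E \<union> F \<and> successively (\<lambda>G G'. card (G \<inter> G') = d - 1) Es"
    and zero: "\<And>s. (\<And>E. E \<in> H \<Longrightarrow> s E = 0) \<Longrightarrow> Q s"
    and add: "\<And>s t. Q s \<Longrightarrow> Q t \<Longrightarrow> Q (\<lambda>E. s E + t E)"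
    and mult: "\<And>c s. Q s \<Longrightarrow> Q (\<lambda>E. c * s E)"
    and linear: "\<And>E F. E \<in> H \<Longrightarrow> F \<in> H \<Longrightarrow> E \<noteq> F \<Longrightarrow> card (E \<inter> F) = d - 1 \<Longrightarrow> Q (linear_syzygy E F)"
  shows "Q s"
proof -
  define \<delta> :: "('v \<Rightarrow>\<^sub>0 nat) \<Rightarrow> 'k \<Rightarrow> 'v set \<Rightarrow> 'v set \<Rightarrow> ('v, 'k) mpoly"
    where "\<delta> m c E = (\<lambda>G. if G = E then monomial (m - expo E) c else 0)" for m c E
  (* \<delta> m c E is the vector whose only term is c times e_E, in multidegree m. *)
  have step: "Q (\<lambda>G. \<delta> m c E G - \<delta> m c F G)"
    if EF: "E \<in> H" "F \<in> H" "card (E \<inter> F) = d - 1" "E \<subseteq> supp m" "F \<subseteq> supp m" for m c E F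
  proof (cases "E = F")
    case True
    then show ?thesis by (intro zero) simp
  next
    case False
    have "m - expo (E \<union> F) + expo (F - E) = m - expo E" "m - expo (E \<union> F) + expo (E - F) = m - expo F"
      using EF(4,5) by (auto intro!: poly_mapping_eqI simp: lookup_add lookup_minus coef_expo in_keys_iff subset_iff)
    then have "(\<lambda>G. monomial (m - expo (E \<union> F)) c * linear_syzygy E F G) = (\<lambda>G. \<delta> m c E G - \<delta> m c F G)"
      using False by (auto simp: fun_eq_iff linear_syzygy_def \<delta>_def mult_single)
    then show ?thesis using mult[OF linear[OF EF(1,2) False EF(3)], of "monomial (m - expo (E \<union> F)) c"] by simp
  qed
  have walk: "Q (\<lambda>G. \<delta> m c (hd Es) G - \<delta> m c (last Es) G)"
    if "Es \<noteq> []" "set Es \<subseteq> H" "\<Union> (set Es) \<subseteq> supp m" "successively (\<lambda>G G'. card (G \<inter> G') = d - 1) Es" for m c Es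
    using that
  proof (induction Es)
    case (Cons E Es)
    show ?case
    proof (cases "Es = []")
      case True
      then show ?thesis by (intro zero) simp
    next
      case False
      have "hd Es \<subseteq> \<Union> (set (E # Es))" by (rule Union_upper) (use False in simp)
      also note Cons.prems(3)
      finally have "Q (\<lambda>G. \<delta> m c E G - \<delta> m c (hd Es) G)"
        using Cons.prems False by (intro step) (auto simp: successively_Cons)
      moreover have "Q (\<lambda>G. \<delta> m c (hd Es) G - \<delta> m c (last Es) G)"
        using Cons False by (auto simp: successively_Cons)
      ultimately have "Q (\<lambda>G. (\<delta> m c E G - \<delta> m c (hd Es) G) + (\<delta> m c (hd Es) G - \<delta> m c (last Es) G))"
        by (rule add)
      then show ?thesis using False by simp
    qed
  qed simp
  show ?thesis
    using s
  proof (induction "\<Sum>E\<in>H. card (supp (s E))" arbitrary: s rule: less_induct)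
    case less
    show ?case
    proof (cases "\<forall>E\<in>H. s E = 0")
      case True
      then show ?thesis by (intro zero) simp
    next
      case False
      then obtain E where E: "E \<in> H" "s E \<noteq> 0" by blast
      then obtain u where u: "u \<in> supp (s E)" by (metis keys_eq_empty all_not_in_conv)
      define m where "m = u + expo E"
      define cf where "cf G = (if G \<subseteq> supp m then coef (s G) (m - expo G) else 0)" for G
      define c where "c = coef (s E) u"
      have Em: "E \<subseteq> supp m" "m - expo E = u" by (simp_all add: m_def supp_add)
      have cE: "cf E = c" "c \<noteq> 0" using u Em by (simp_all add: cf_def c_def in_keys_iff)
      have "coef (\<Sum>G\<in>H. s G * monomial (expo G) 1) m = 0" using less.prems by (simp add: is_syzygy_def)
      then have "(\<Sum>G\<in>H. cf G) = 0" unfolding coef_syzygy_sum cf_def .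
      then have "(\<Sum>G\<in>H - {E}. cf G) \<noteq> 0" using cE E(1) by (auto simp: sum.remove)
      then obtain F where F: "F \<in> H" "F \<noteq> E" "cf F \<noteq> 0"
        by (metis DiffE insertI1 sum.not_neutral_contains_not_neutral)
      then have Fm: "F \<subseteq> supp m" "m - expo F \<in> supp (s F)"
        by (auto simp: cf_def in_keys_iff split: if_splits)
      define t where "t = (\<lambda>G. \<delta> m c E G - \<delta> m c F G)"
      define s' where "s' = (\<lambda>G. s G - t G)"
      have t: "t = (\<lambda>G. if G = E then monomial u c else if G = F then - monomial (m - expo F) c else 0)"
        using F(2) Em by (auto simp: t_def \<delta>_def fun_eq_iff)
      obtain Es where Es: "Es \<noteq> []" "hd Es = E" "last Es = F" "set Es \<subseteq> H" "\<Union> (set Es) \<subseteq> E \<union> F"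
          "successively (\<lambda>G G'. card (G \<inter> G') = d - 1) Es"
        using links[OF E(1) F(1)] by blast
      have "\<Union> (set Es) \<subseteq> supp m" using Es(5) Em(1) Fm(1) by blast
      from walk[OF Es(1,4) this Es(6), of c] have "Q t" by (simp add: t_def Es)
      have "is_syzygy H t"
        unfolding t using E F Fm by (intro is_syzygy_two_points) (auto simp: m_def diff_expo_add)
      then have "is_syzygy H s'"
        using less.prems by (simp add: is_syzygy_def s'_def left_diff_distrib sum_subtractf)
      moreover have "(\<Sum>G\<in>H. card (supp (s' G))) < (\<Sum>G\<in>H. card (supp (s G)))"
      proof (rule sum_strict_mono_ex1)
        have sub: "supp (s' G) \<subseteq> supp (s G)" for G
          using u Fm by (auto simp: s'_def t in_keys_iff lookup_add lookup_minus lookup_single when_def split: if_splits)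
        then show "\<forall>G\<in>H. card (supp (s' G)) \<le> card (supp (s G))" by (simp add: card_mono)
        have "u \<notin> supp (s' E)" by (simp add: s'_def t in_keys_iff lookup_minus c_def)
        then have "supp (s' E) \<subset> supp (s E)" using sub u by blast
        then show "\<exists>G\<in>H. card (supp (s' G)) < card (supp (s G))"
          using E(1) by (intro bexI[of _ E] psubset_card_mono) auto
      qed simp
      ultimately have "Q s'" by (intro less.hyps)
      from add[OF this \<open>Q t\<close>] show ?thesis by (simp add: s'_def)
    qed
  qed
qed

text \<open>The coefficient of \<open>x\<^sub>v x^E\<close> in a syzygy only involves edges inside
\<open>insert v E\<close>.\<close>

lemma coef_linear_syzygy_entry:
  fixes l :: "'v::finite set \<Rightarrow> ('v, 'k::field) mpoly"
  assumes "is_syzygy H l" "E \<in> H" "v \<notin> E" and only: "\<And>G. G \<in> H \<Longrightarrow> G \<subseteq> insert v E \<Longrightarrow> G = E"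
  shows "coef (l E) (expo {v}) = 0"
proof -
  let ?m = "expo {v} + expo E"
  have "0 = coef (\<Sum>G\<in>H. l G * monomial (expo G) 1) ?m"
    using assms(1) by (simp add: is_syzygy_def)
  also have "\<dots> = (\<Sum>G\<in>H. if G = E then coef (l E) (expo {v}) else 0)"
    unfolding coef_syzygy_sum
  proof (rule sum.cong)
    fix G assume G: "G \<in> H"
    have "G \<subseteq> supp ?m \<longleftrightarrow> G = E"
      using only[OF G] by (auto simp: supp_add)
    then show "(if G \<subseteq> supp ?m then coef (l G) (?m - expo G) else 0) = (if G = E then coef (l E) (expo {v}) else 0)"
      by simp
  qed simp
  also have "\<dots> = coef (l E) (expo {v})" using assms(2) by simp
  finally show ?thesis by simp
qed

section \<open>Comparing a minimal presentation with the edge monomials\<close>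

text \<open>The end \<open>F\<^sub>1 \<longrightarrow> F\<^sub>0 \<longrightarrow> I \<longrightarrow> 0\<close> of a minimal graded free resolution of the edge
ideal, written out with sums: \<open>f\<close> is the row of generators and \<open>g\<close> the matrix of their
relations, with degrees \<open>a\<^sub>0\<close> and \<open>a\<^sub>1\<close> of the basis elements. Minimality is recorded by
its consequence that relations between the columns of \<open>f\<close>, and of \<open>g\<close>, have no constant
terms.\<close>

locale minimal_presentation =
  fixes H :: "'v::finite set set" and d :: nat
    and n\<^sub>0 :: nat and f :: "nat \<Rightarrow> ('v, 'k::field) mpoly" and a\<^sub>0 :: "nat \<Rightarrow> nat"
    and n\<^sub>1 :: nat and g :: "nat \<Rightarrow> nat \<Rightarrow> ('v, 'k) mpoly" and a\<^sub>1 :: "nat \<Rightarrow> nat"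
  assumes uniform: "uniform d H"
    and generators: "x \<in> edge_ideal H \<longleftrightarrow> (\<exists>w. x = (\<Sum>p<n\<^sub>0. f p * w p))"
    and exact: "(\<Sum>p<n\<^sub>0. f p * w p) = 0 \<longleftrightarrow> (\<exists>u. \<forall>p<n\<^sub>0. w p = (\<Sum>q<n\<^sub>1. g p q * u q))"
    and f_graded: "p < n\<^sub>0 \<Longrightarrow> m \<in> supp (f p) \<Longrightarrow> mdeg m = a\<^sub>0 p"
    and g_graded: "p < n\<^sub>0 \<Longrightarrow> q < n\<^sub>1 \<Longrightarrow> m \<in> supp (g p q) \<Longrightarrow> mdeg m + a\<^sub>0 p = a\<^sub>1 q"
    and f_minimal: "(\<Sum>p<n\<^sub>0. f p * w p) = 0 \<Longrightarrow> p < n\<^sub>0 \<Longrightarrow> coef (w p) 0 = 0"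
    and g_minimal: "(\<And>p. p < n\<^sub>0 \<Longrightarrow> (\<Sum>q<n\<^sub>1. g p q * u q) = 0) \<Longrightarrow> q < n\<^sub>1 \<Longrightarrow> coef (u q) 0 = 0"
begin

lemma sum_indicator:
  fixes h :: "nat \<Rightarrow> ('v, 'k) mpoly"
  shows "q < n \<Longrightarrow> (\<Sum>p<n. h p * (if p = q then 1 else 0)) = h q"
  by (simp add: if_distrib cong: if_cong)

lemma card_edge: "E \<in> H \<Longrightarrow> card E = d"
  using uniform by (simp add: uniform_def)

lemma generator_in_ideal: "p < n\<^sub>0 \<Longrightarrow> f p \<in> edge_ideal H"
  unfolding generators by (rule exI[of _ "\<lambda>q. if q = p then 1 else 0"]) (simp only: sum_indicator)

lemma edge_monomial_in_ideal:
  assumes "E \<in> H" shows "(monomial (expo E) 1 :: ('v, 'k) mpoly) \<in> edge_ideal H"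
proof -
  have "(\<Sum>F\<in>H. (if F = E then 1 else 0) * monomial (expo F) 1) = (\<Sum>F\<in>H. if F = E then monomial (expo F) (1::'k) else 0)"
    by (rule sum.cong) auto
  also have "\<dots> = monomial (expo E) 1" using assms by simp
  finally show ?thesis unfolding in_edge_ideal_iff by (rule exI[of _ "\<lambda>F. if F = E then 1 else 0", OF sym])
qed

text \<open>An arbitrary preimage of the edge monomial in \<open>F\<^sub>0\<close>.\<close>

definition lift_edge :: "'v set \<Rightarrow> nat \<Rightarrow> ('v, 'k) mpoly" where
  "lift_edge E = (SOME w. monomial (expo E) 1 = (\<Sum>p<n\<^sub>0. f p * w p))"

lemma lift_edge: "E \<in> H \<Longrightarrow> monomial (expo E) 1 = (\<Sum>p<n\<^sub>0. f p * lift_edge E p)"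
  using someI_ex[of "\<lambda>w. monomial (expo E) 1 = (\<Sum>p<n\<^sub>0. f p * w p)"] edge_monomial_in_ideal[of E]
  by (simp add: generators lift_edge_def)

text \<open>The scalar matrices of the base change between \<open>F\<^sub>0\<close> and the free module on the edges.
They consist of coefficients of \<open>f p\<close> and of constant terms of preimages of the edge
monomials; the next lemmas show, by comparing degrees, that nothing else remains and that the
matrices are inverse to each other.\<close>

definition to_edge :: "nat \<Rightarrow> 'v set \<Rightarrow> 'k" where
  "to_edge p E = coef (f p) (expo E)"

definition from_edge :: "'v set \<Rightarrow> nat \<Rightarrow> 'k" where
  "from_edge E p = coef (lift_edge E p) 0"

text \<open>All edge monomials have degree \<open>d\<close>, and they generate the ideal.\<close>

lemma generator_degree:
  assumes p: "p < n\<^sub>0"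
  shows "a\<^sub>0 p = d"
proof (rule ccontr)
  assume deg: "a\<^sub>0 p \<noteq> d"
  have lift_edge_0: "coef (lift_edge E p) 0 = 0" if E: "E \<in> H" for E
  proof (rule constant_coef_of_graded_preimage[where P = "{()}" and g = "\<lambda>_. f" and b = "\<lambda>_. 0" and a = a\<^sub>0
        and n = n\<^sub>0 and D = d])
    fix m assume "m \<in> supp (\<Sum>q<n\<^sub>0. f q * lift_edge E q)"
    then have "m \<in> supp (monomial (expo E) (1::'k))" by (simp only: lift_edge[OF E])
    then show "mdeg m + 0 = d" using card_edge[OF E] by simp
  next
    fix w q assume "\<And>x. x \<in> {()} \<Longrightarrow> (\<Sum>q<n\<^sub>0. f q * w q) = 0" "q < n\<^sub>0"
    then show "coef (w q) 0 = 0" using f_minimal by blast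
  qed (use deg p f_graded in simp_all)
  obtain c where c: "f p = (\<Sum>E\<in>H. c E * monomial (expo E) 1)"
    using generator_in_ideal[OF p] by (auto simp: in_edge_ideal_iff)
  also have "\<dots> = (\<Sum>E\<in>H. \<Sum>q<n\<^sub>0. f q * (c E * lift_edge E q))"
    by (rule sum.cong) (simp_all add: lift_edge sum_distrib_left mult_ac)
  also have "\<dots> = (\<Sum>q<n\<^sub>0. f q * (\<Sum>E\<in>H. c E * lift_edge E q))"
    by (subst sum.swap) (simp add: sum_distrib_left)
  finally have "coef (\<Sum>E\<in>H. c E * lift_edge E p) 0 = 1"
    using constant_coef_of_column_preimage[where P = "{()}" and g = "\<lambda>_. f" and n = n\<^sub>0 and q = p
        and w = "\<lambda>q. \<Sum>E\<in>H. c E * lift_edge E q"] f_minimal p by simp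
  moreover have "coef (\<Sum>E\<in>H. c E * lift_edge E p) 0 = 0"
    by (simp add: lookup_sum coef_zero_mult lift_edge_0)
  ultimately show False by simp
qed

lemma homog_generator: "p < n\<^sub>0 \<Longrightarrow> homog d (f p)"
  using f_graded generator_degree by (simp add: homog_def)

lemma generator_expansion:
  assumes p: "p < n\<^sub>0"
  shows "f p = (\<Sum>E\<in>H. scalar (to_edge p E) * monomial (expo E) 1)"
proof (rule poly_mapping_eqI)
  fix m
  obtain c where c: "f p = (\<Sum>E\<in>H. c E * monomial (expo E) 1)"
    using generator_in_ideal[OF p] by (auto simp: in_edge_ideal_iff)
  have rhs: "coef (\<Sum>E\<in>H. scalar (to_edge p E) * monomial (expo E) 1) m = (\<Sum>E\<in>H. if expo E = m then to_edge p E else 0)"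
    by (simp add: lookup_sum mult_single lookup_single when_def cong: if_cong)
  show "coef (f p) m = coef (\<Sum>E\<in>H. scalar (to_edge p E) * monomial (expo E) 1) m"
  proof (cases "\<exists>E\<in>H. expo E = m")
    case True
    then obtain E where E: "E \<in> H" "m = expo E" by blast
    then show ?thesis unfolding rhs by (simp add: to_edge_def cong: if_cong)
  next
    case False
    have "coef (f p) m = 0"
    proof (cases "mdeg m = d")
      case True
      have "coef (c E * monomial (expo E) 1) m = 0" if E: "E \<in> H" for E
        using coef_homog_mult[of d "monomial (expo E) 1" m "c E"] True False E card_edge[OF E]
        by (auto simp: homog_def mult.commute[of "c E"] lookup_single when_def)
      then show ?thesis by (simp add: c lookup_sum)
    next
      case False
      then show ?thesis using homog_generator[OF p] by (auto simp: homog_def in_keys_iff)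
    qed
    then show ?thesis unfolding rhs using False by (auto intro!: sum.neutral)
  qed
qed

lemma edge_monomial_expansion:
  assumes E: "E \<in> H"
  shows "monomial (expo E) 1 = (\<Sum>p<n\<^sub>0. f p * scalar (from_edge E p))"
proof (rule poly_mapping_eqI)
  fix m
  show "coef (monomial (expo E) 1) m = coef (\<Sum>p<n\<^sub>0. f p * scalar (from_edge E p)) m"
  proof (cases "mdeg m = d")
    case True
    then have "coef (f p * lift_edge E p) m = coef (f p * scalar (from_edge E p)) m" if "p < n\<^sub>0" for p
      using coef_homog_mult[OF homog_generator[OF that]] by (simp add: from_edge_def)
    then show ?thesis by (simp add: lift_edge[OF E] lookup_sum)
  next
    case False
    have "coef (f p * scalar (from_edge E p)) m = 0" if "p < n\<^sub>0" for p
      using homog_generator[OF that] False by (auto simp: coef_scalar_mult homog_def in_keys_iff)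
    moreover have "expo E \<noteq> m" using False card_edge[OF E] by auto
    ultimately show ?thesis by (simp add: lookup_sum lookup_single)
  qed
qed

lemma to_edge_from_edge:
  assumes "E \<in> H"
  shows "(\<Sum>p<n\<^sub>0. to_edge p G * from_edge E p) = (if G = E then 1 else 0)"
proof -
  have "(\<Sum>p<n\<^sub>0. to_edge p G * from_edge E p) = coef (\<Sum>p<n\<^sub>0. f p * scalar (from_edge E p)) (expo G)"
    by (simp add: lookup_sum coef_scalar_mult to_edge_def)
  also have "\<dots> = (if G = E then 1 else 0)"
    by (simp add: lookup_single when_def flip: edge_monomial_expansion[OF assms])
  finally show ?thesis .
qed

text \<open>Expanding a generator in edge monomials and these again in generators gives a relation between
the generators with scalar coefficients, which has to be trivial by minimality.\<close>

lemma from_edge_to_edge: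
  assumes p: "p < n\<^sub>0" and q: "q < n\<^sub>0"
  shows "(\<Sum>E\<in>H. from_edge E p * to_edge q E) = (if p = q then 1 else 0)"
proof -
  define z :: "nat \<Rightarrow> ('v, 'k) mpoly" where "z p = scalar ((if p = q then 1 else 0) - (\<Sum>E\<in>H. from_edge E p * to_edge q E))" for p
  have "(\<Sum>p<n\<^sub>0. f p * z p) = (\<Sum>p<n\<^sub>0. f p * (if p = q then 1 else 0) -
      (\<Sum>E\<in>H. f p * scalar (from_edge E p) * scalar (to_edge q E)))"
  proof (rule sum.cong)
    fix p
    have "z p = (if p = q then 1 else 0) - (\<Sum>E\<in>H. scalar (from_edge E p) * scalar (to_edge q E))"
      by (simp add: z_def single_diff scalar_sum mult_single)
    then show "f p * z p = f p * (if p = q then 1 else 0) - (\<Sum>E\<in>H. f p * scalar (from_edge E p) * scalar (to_edge q E))"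
      by (simp only: right_diff_distrib sum_distrib_left mult.assoc)
  qed simp
  also have "\<dots> = f q - (\<Sum>E\<in>H. (\<Sum>p<n\<^sub>0. f p * scalar (from_edge E p)) * scalar (to_edge q E))"
    unfolding sum_subtractf sum_indicator[OF q] by (subst sum.swap) (simp only: sum_distrib_right)
  also have "\<dots> = 0"
    by (subst generator_expansion[OF q]) (simp add: mult.commute flip: edge_monomial_expansion)
  finally have "coef (z p) 0 = 0" using f_minimal p by blast
  then have "(if p = q then 1 else 0) - (\<Sum>E\<in>H. from_edge E p * to_edge q E) = 0"
    by (simp only: z_def lookup_single_eq)
  then show ?thesis by (simp only: right_minus_eq)
qed

text \<open>The mutually inverse isomorphisms between \<open>F\<^sub>0\<close> and the free module on the edges.\<close>

definition to_edges :: "(nat \<Rightarrow> ('v, 'k) mpoly) \<Rightarrow> 'v set \<Rightarrow> ('v, 'k) mpoly" where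
  "to_edges w E = (\<Sum>p<n\<^sub>0. scalar (to_edge p E) * w p)"

definition from_edges :: "('v set \<Rightarrow> ('v, 'k) mpoly) \<Rightarrow> nat \<Rightarrow> ('v, 'k) mpoly" where
  "from_edges s p = (\<Sum>E\<in>H. scalar (from_edge E p) * s E)"

lemma to_edges_from_edges:
  assumes "E \<in> H"
  shows "to_edges (from_edges s) E = s E"
proof -
  have "to_edges (from_edges s) E = (\<Sum>G\<in>H. scalar (\<Sum>p<n\<^sub>0. to_edge p E * from_edge G p) * s G)"
    unfolding to_edges_def from_edges_def sum_distrib_left
    by (subst sum.swap) (simp add: scalar_sum sum_distrib_right mult_single flip: mult.assoc)
  also have "\<dots> = (\<Sum>G\<in>H. if E = G then s G else 0)"
    by (rule sum.cong) (simp_all add: to_edge_from_edge)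
  finally show ?thesis using assms by simp
qed

lemma from_edges_to_edges:
  assumes p: "p < n\<^sub>0"
  shows "from_edges (to_edges w) p = w p"
proof -
  have "from_edges (to_edges w) p = (\<Sum>q<n\<^sub>0. scalar (\<Sum>E\<in>H. from_edge E p * to_edge q E) * w q)"
    unfolding to_edges_def from_edges_def sum_distrib_left
    by (subst sum.swap) (simp add: scalar_sum sum_distrib_right mult_single flip: mult.assoc)
  also have "\<dots> = (\<Sum>q<n\<^sub>0. if p = q then w q else 0)"
    by (rule sum.cong) (simp_all add: from_edge_to_edge p)
  finally show ?thesis using p by simp
qed

lemma syzygy_to_edges: "is_syzygy H (to_edges w) \<longleftrightarrow> (\<Sum>p<n\<^sub>0. f p * w p) = 0"
proof -
  have "(\<Sum>E\<in>H. to_edges w E * monomial (expo E) 1) = (\<Sum>p<n\<^sub>0. (\<Sum>E\<in>H. scalar (to_edge p E) * monomial (expo E) 1) * w p)"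
    unfolding to_edges_def sum_distrib_right by (subst sum.swap) (simp add: mult_ac)
  also have "\<dots> = (\<Sum>p<n\<^sub>0. f p * w p)"
    by (rule sum.cong) (simp_all flip: generator_expansion)
  finally show ?thesis by (simp add: is_syzygy_def)
qed

lemma from_edges_syzygy:
  assumes "is_syzygy H s"
  shows "(\<Sum>p<n\<^sub>0. f p * from_edges s p) = 0"
proof -
  have "is_syzygy H (to_edges (from_edges s))"
    using assms by (simp add: is_syzygy_def to_edges_from_edges)
  then show ?thesis by (simp add: syzygy_to_edges)
qed

lemma column_in_kernel: "q < n\<^sub>1 \<Longrightarrow> (\<Sum>p<n\<^sub>0. f p * g p q) = 0"
  unfolding exact by (rule exI[of _ "\<lambda>q'. if q' = q then 1 else 0"]) (simp only: sum_indicator simp_thms)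

text \<open>The syzygy \<open>x^F e\<^sub>E - x^E e\<^sub>F\<close> is a combination of the columns of \<open>g\<close>, which are linear.
Since its entry at \<open>E\<close> is \<open>x^F\<close>, some column has a term \<open>x\<^sub>v\<close> with \<open>v \<in> F\<close> at
\<open>E\<close>, and this forces another edge inside \<open>insert v E\<close>.\<close>

lemma linear_imp_neighbour:
  assumes linear: "\<And>q. q < n\<^sub>1 \<Longrightarrow> a\<^sub>1 q = d + 1"
    and EF: "E \<in> H" "F \<in> H" "E \<inter> F = {}" "E \<noteq> F"
  obtains G v where "G \<in> H" "G \<noteq> E" "v \<in> F" "G \<subseteq> insert v E"
proof (rule ccontr)
  assume no_neighbour: "\<not> thesis"
  note neighbour = that
  have only: "G = E" if "v \<in> F" "G \<in> H" "G \<subseteq> insert v E" for v G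
    using no_neighbour neighbour[OF that(2) _ that(1,3)] by blast
  define s :: "'v set \<Rightarrow> ('v, 'k) mpoly" where
    "s = (\<lambda>G. if G = E then monomial (expo F) 1 else if G = F then - monomial (expo E) 1 else 0)"
  have "is_syzygy H s" unfolding s_def using EF by (intro is_syzygy_two_points) (auto simp: add.commute)
  then obtain u where u: "\<And>p. p < n\<^sub>0 \<Longrightarrow> from_edges s p = (\<Sum>q<n\<^sub>1. g p q * u q)"
    using from_edges_syzygy[of s] exact by blast
  define l where "l q = to_edges (\<lambda>p. g p q)" for q
  have l_syz: "is_syzygy H (l q)" if "q < n\<^sub>1" for q
    using column_in_kernel[OF that] by (simp add: l_def syzygy_to_edges)
  have "monomial (expo F) 1 = to_edges (from_edges s) E"
    by (simp add: to_edges_from_edges EF s_def)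
  also have "\<dots> = (\<Sum>p<n\<^sub>0. \<Sum>q<n\<^sub>1. scalar (to_edge p E) * g p q * u q)"
    unfolding to_edges_def by (rule sum.cong) (simp_all add: u sum_distrib_left mult.assoc)
  also have "\<dots> = (\<Sum>q<n\<^sub>1. l q E * u q)"
    unfolding l_def to_edges_def sum_distrib_right by (rule sum.swap)
  finally have "expo F \<in> supp (\<Sum>q<n\<^sub>1. l q E * u q)" by (metis keys_single one_neq_zero singletonI)
  then obtain q k k' where q: "q < n\<^sub>1" "k \<in> supp (l q E)" "expo F = k + k'" by (rule in_supp_sum_multE)
  from q(2) obtain p where "p < n\<^sub>0" "k \<in> supp (g p q)"
  proof -
    have "\<exists>p<n\<^sub>0. coef (scalar (to_edge p E) * g p q) k \<noteq> 0"
      using q(2) by (auto simp: l_def to_edges_def in_keys_iff lookup_sum dest: sum.not_neutral_contains_not_neutral)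
    then show ?thesis using that by (auto simp: coef_scalar_mult in_keys_iff)
  qed
  then have "mdeg k + d = d + 1" using g_graded[of p q k] q(1) linear generator_degree by simp
  then have "mdeg k = 1" by simp
  then obtain v where v: "k = expo {v}" by (rule mdeg_eq_1E)
  have "v \<in> F" using arg_cong[OF q(3), of supp] by (simp add: supp_add v)
  then have "coef (l q E) (expo {v}) = 0"
    using EF only by (intro coef_linear_syzygy_entry[OF l_syz[OF q(1)]]) auto
  then show False using q(2) v by (simp add: in_keys_iff)
qed

text \<open>If the degree of the column \<open>q\<close> were not \<open>d + 1\<close>, every linear syzygy would be an image
under \<open>g\<close> of a vector without constant term at \<open>q\<close>. This property passes to all
combinations of linear syzygies, hence to all syzygies. It would hold for the column \<open>q\<close>
itself, which is impossible.\<close>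

lemma linked_imp_linear:
  assumes links: "\<And>E F. E \<in> H \<Longrightarrow> F \<in> H \<Longrightarrow> \<exists>Es. Es \<noteq> [] \<and> hd Es = E \<and> last Es = F \<and> set Es \<subseteq> H \<and>
      \<Union> (set Es) \<subseteq> E \<union> F \<and> successively (\<lambda>G G'. card (G \<inter> G') = d - 1) Es"
    and q: "q < n\<^sub>1"
  shows "a\<^sub>1 q = d + 1"
proof (rule ccontr)
  assume deg: "a\<^sub>1 q \<noteq> d + 1"
  have min: "coef (w q') 0 = 0"
    if "\<And>p. p \<in> {..<n\<^sub>0} \<Longrightarrow> (\<Sum>q<n\<^sub>1. g p q * w q) = 0" "q' < n\<^sub>1" for w q'
    using that g_minimal by blast
  define Q where "Q s \<longleftrightarrow> (\<exists>w. (\<forall>p<n\<^sub>0. from_edges s p = (\<Sum>q<n\<^sub>1. g p q * w q)) \<and> coef (w q) 0 = 0)"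
    for s :: "'v set \<Rightarrow> ('v, 'k) mpoly"
  have "is_syzygy H (to_edges (\<lambda>p. g p q))"
    using column_in_kernel[OF q] by (simp add: syzygy_to_edges)
  then have "Q (to_edges (\<lambda>p. g p q))"
  proof (rule syzygy_linear_induct[OF _ links])
    fix s :: "'v set \<Rightarrow> ('v, 'k) mpoly" assume "\<And>E. E \<in> H \<Longrightarrow> s E = 0"
    then show "Q s" unfolding Q_def by (intro exI[of _ "\<lambda>_. 0"]) (simp add: from_edges_def)
  next
    fix s t assume "Q s" "Q t"
    then obtain w w' where
      "\<forall>p<n\<^sub>0. from_edges s p = (\<Sum>q<n\<^sub>1. g p q * w q)" "coef (w q) 0 = 0"
      "\<forall>p<n\<^sub>0. from_edges t p = (\<Sum>q<n\<^sub>1. g p q * w' q)" "coef (w' q) 0 = 0" unfolding Q_def by blast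
    then show "Q (\<lambda>E. s E + t E)" unfolding Q_def
      by (intro exI[of _ "\<lambda>q. w q + w' q"]) (simp add: from_edges_def distrib_left sum.distrib lookup_add)
  next
    fix c s assume "Q s"
    then obtain w where w: "\<And>p. p < n\<^sub>0 \<Longrightarrow> from_edges s p = (\<Sum>q<n\<^sub>1. g p q * w q)" "coef (w q) 0 = 0"
      unfolding Q_def by blast
    have "from_edges (\<lambda>E. c * s E) p = (\<Sum>q<n\<^sub>1. g p q * (c * w q))" if "p < n\<^sub>0" for p
    proof -
      have "from_edges (\<lambda>E. c * s E) p = c * from_edges s p"
        by (simp add: from_edges_def sum_distrib_left mult_ac)
      then show ?thesis using w(1)[OF that] by (simp add: sum_distrib_left mult_ac)
    qed
    moreover have "coef (c * w q) 0 = 0" using w(2) by (simp add: coef_zero_mult)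
    ultimately show "Q (\<lambda>E. c * s E)" unfolding Q_def by (intro exI[of _ "\<lambda>q. c * w q"]) simp
  next
    fix E F assume EF: "E \<in> H" "F \<in> H" "E \<noteq> F" "card (E \<inter> F) = d - 1"
    have "d > 0" using EF card_edge by (metis card_0_eq finite gr0I)
    then have card: "card (E - F) = 1" "card (F - E) = 1"
      using EF card_edge by (simp_all add: card_Diff_subset_Int Int_commute)
    have "expo (F - E) + expo E = expo (E - F) + expo F"
      by (rule poly_mapping_eqI) (auto simp: lookup_add coef_expo)
    then have "is_syzygy H (linear_syzygy E F :: _ \<Rightarrow> ('v, 'k) mpoly)"
      unfolding linear_syzygy_def using EF by (intro is_syzygy_two_points) auto
    then obtain w where w: "\<forall>p<n\<^sub>0. from_edges (linear_syzygy E F) p = (\<Sum>q<n\<^sub>1. g p q * w q)"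
      using from_edges_syzygy exact by blast
    have "coef (w q) 0 = 0"
    proof (rule constant_coef_of_graded_preimage[where P = "{..<n\<^sub>0}" and g = g and b = a\<^sub>0 and a = a\<^sub>1 and D = "d + 1"])
      fix p m assume p: "p \<in> {..<n\<^sub>0}" and "m \<in> supp (\<Sum>q<n\<^sub>1. g p q * w q)"
      then have "m \<in> supp (from_edges (linear_syzygy E F) p)" using w by simp
      then have "\<exists>G\<in>H. coef (scalar (from_edge G p) * linear_syzygy E F G) m \<noteq> 0"
        by (auto simp: from_edges_def in_keys_iff lookup_sum dest: sum.not_neutral_contains_not_neutral)
      then have "m = expo (E - F) \<or> m = expo (F - E)"
        by (auto simp: coef_scalar_mult linear_syzygy_def lookup_single when_def split: if_splits)
      then show "mdeg m + a\<^sub>0 p = d + 1" using p card generator_degree by auto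
    qed (use q deg g_graded min in auto)
    then show "Q (linear_syzygy E F)" using w unfolding Q_def by blast
  qed
  then obtain w where w: "\<forall>p<n\<^sub>0. from_edges (to_edges (\<lambda>p. g p q)) p = (\<Sum>q<n\<^sub>1. g p q * w q)"
    "coef (w q) 0 = 0" unfolding Q_def by blast
  have "coef (w q) 0 = 1"
    by (rule constant_coef_of_column_preimage[where P = "{..<n\<^sub>0}" and g = g and n = n\<^sub>1])
      (use w q min in \<open>auto simp: from_edges_to_edges\<close>)
  then show False using w by simp
qed

end

section \<open>Linear first syzygies and the edge diameter\<close>

text \<open>Passes from matrices and vectors to sums. A relation between the columns of one map is an image
under the next one, whose entries have no constant terms.\<close>

lemma minimal_presentation_of_resolution:
  fixes \<phi> :: "nat \<Rightarrow> ('v::finite, 'k::field) mpoly mat"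
  assumes res: "minimal_graded_free_resolution (edge_ideal H) \<phi> a" and u: "uniform d H"
  shows "minimal_presentation H d (dim_col (\<phi> 0)) (\<lambda>p. \<phi> 0 $$ (0, p)) (a 0)
    (dim_col (\<phi> 1)) (\<lambda>p q. \<phi> 1 $$ (p, q)) (a 1)"
proof -
  have rows: "dim_row (\<phi> 0) = 1" "dim_row (\<phi> (Suc i)) = dim_col (\<phi> i)"
    and image: "edge_ideal H = {(\<phi> 0 *\<^sub>v w) $ 0 |w. w \<in> carrier_vec (dim_col (\<phi> 0))}"
    and ker: "mat_kernel (\<phi> i) = {\<phi> (Suc i) *\<^sub>v w |w. w \<in> carrier_vec (dim_col (\<phi> (Suc i)))}"
    and graded0: "\<forall>q<dim_col (\<phi> 0). \<forall>m\<in>supp (\<phi> 0 $$ (0, q)). mdeg m = a 0 q"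
    and graded: "\<forall>p<dim_row (\<phi> (Suc i)). \<forall>q<dim_col (\<phi> (Suc i)). \<forall>m\<in>supp (\<phi> (Suc i) $$ (p, q)).
       mdeg m + a i p = a (Suc i) q"
    and scalar: "\<forall>p<dim_row (\<phi> (Suc i)). \<forall>q<dim_col (\<phi> (Suc i)). coef (\<phi> (Suc i) $$ (p, q)) 0 = 0" for i
    using res unfolding minimal_graded_free_resolution_def by blast+
  have mult: "(\<phi> i *\<^sub>v vec (dim_col (\<phi> i)) w) $ p = (\<Sum>q<dim_col (\<phi> i). \<phi> i $$ (p, q) * w q)"
    if "p < dim_row (\<phi> i)" for i p w
    using that by (simp add: scalar_prod_def atLeast0LessThan)
  have vec_surj: "\<exists>u. w = vec n u" if "w \<in> carrier_vec n" for w :: "('v, 'k) mpoly vec" and n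
    using that by (intro exI[of _ "\<lambda>i. w $ i"]) auto
  have exact: "(\<forall>r<dim_row (\<phi> i). (\<Sum>p<dim_col (\<phi> i). \<phi> i $$ (r, p) * w p) = 0) \<longleftrightarrow>
      (\<exists>u. \<forall>p<dim_col (\<phi> i). w p = (\<Sum>q<dim_col (\<phi> (Suc i)). \<phi> (Suc i) $$ (p, q) * u q))" for i w
  proof -
    let ?w = "vec (dim_col (\<phi> i)) w"
    have "(\<forall>r<dim_row (\<phi> i). (\<Sum>p<dim_col (\<phi> i). \<phi> i $$ (r, p) * w p) = 0) \<longleftrightarrow> ?w \<in> mat_kernel (\<phi> i)"
      using mult[of _ i w] by (auto simp: mat_kernel_def vec_eq_iff simp del: index_mult_mat_vec)
    also have "\<dots> \<longleftrightarrow> (\<exists>u. ?w = \<phi> (Suc i) *\<^sub>v vec (dim_col (\<phi> (Suc i))) u)"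
    proof
      assume "?w \<in> mat_kernel (\<phi> i)"
      then obtain U where U: "U \<in> carrier_vec (dim_col (\<phi> (Suc i)))" "?w = \<phi> (Suc i) *\<^sub>v U"
        unfolding ker[of i] by blast
      then show "\<exists>u. ?w = \<phi> (Suc i) *\<^sub>v vec (dim_col (\<phi> (Suc i))) u" using vec_surj[OF U(1)] by blast
    next
      assume "\<exists>u. ?w = \<phi> (Suc i) *\<^sub>v vec (dim_col (\<phi> (Suc i))) u"
      then obtain u where "?w = \<phi> (Suc i) *\<^sub>v vec (dim_col (\<phi> (Suc i))) u" ..
      then show "?w \<in> mat_kernel (\<phi> i)"
        unfolding ker[of i] by (intro CollectI exI[of _ "vec (dim_col (\<phi> (Suc i))) u"]) simp
    qed
    also have "\<dots> \<longleftrightarrow> (\<exists>u. \<forall>p<dim_col (\<phi> i). w p = (\<Sum>q<dim_col (\<phi> (Suc i)). \<phi> (Suc i) $$ (p, q) * u q))"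
      using mult[of _ "Suc i"] by (auto simp: vec_eq_iff rows(2) simp del: index_mult_mat_vec)
    finally show ?thesis .
  qed
  have min: "coef (w p) 0 = 0"
    if w: "\<forall>r<dim_row (\<phi> i). (\<Sum>p<dim_col (\<phi> i). \<phi> i $$ (r, p) * w p) = 0"
      and p: "p < dim_col (\<phi> i)" for i w p
  proof -
    obtain u where "\<forall>p<dim_col (\<phi> i). w p = (\<Sum>q<dim_col (\<phi> (Suc i)). \<phi> (Suc i) $$ (p, q) * u q)"
      using iffD1[OF exact w] by (rule exE)
    then show ?thesis using p scalar[of i] by (simp add: lookup_sum coef_zero_mult rows(2))
  qed
  show ?thesis
  proof
    fix x :: "('v, 'k) mpoly"
    show "x \<in> edge_ideal H \<longleftrightarrow> (\<exists>w. x = (\<Sum>p<dim_col (\<phi> 0). \<phi> 0 $$ (0, p) * w p))"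
    proof
      assume "x \<in> edge_ideal H"
      then obtain w where "w \<in> carrier_vec (dim_col (\<phi> 0))" "x = (\<phi> 0 *\<^sub>v w) $ 0" using image by auto
      then show "\<exists>w. x = (\<Sum>p<dim_col (\<phi> 0). \<phi> 0 $$ (0, p) * w p)"
        using vec_surj mult[of 0 0] rows(1) by (metis less_one)
    next
      assume "\<exists>w. x = (\<Sum>p<dim_col (\<phi> 0). \<phi> 0 $$ (0, p) * w p)"
      then obtain w where "x = (\<Sum>p<dim_col (\<phi> 0). \<phi> 0 $$ (0, p) * w p)" ..
      then have "x = (\<phi> 0 *\<^sub>v vec (dim_col (\<phi> 0)) w) $ 0" using mult[of 0 0 w] rows(1) by simp
      then show "x \<in> edge_ideal H" unfolding image by (intro CollectI exI[of _ "vec (dim_col (\<phi> 0)) w"]) simp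
    qed
  next
    fix w
    show "((\<Sum>p<dim_col (\<phi> 0). \<phi> 0 $$ (0, p) * w p) = 0) =
        (\<exists>u. \<forall>p<dim_col (\<phi> 0). w p = (\<Sum>q<dim_col (\<phi> 1). \<phi> 1 $$ (p, q) * u q))"
      using exact[of 0 w] by (simp add: rows(1))
  next
    fix w p assume "(\<Sum>p<dim_col (\<phi> 0). \<phi> 0 $$ (0, p) * w p) = 0" "p < dim_col (\<phi> 0)"
    then show "coef (w p) 0 = 0" using min[of 0 w p] by (simp add: rows(1))
  next
    fix w q assume "\<And>p. p < dim_col (\<phi> 0) \<Longrightarrow> (\<Sum>q<dim_col (\<phi> 1). \<phi> 1 $$ (p, q) * w q) = 0" "q < dim_col (\<phi> 1)"
    then show "coef (w q) 0 = 0" using min[of 1 w q] rows(2)[of 0] by simp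
  qed (use u graded0 graded[of 0] rows(2)[of 0] in auto)
qed

theorem theorem7p4:
  fixes H :: "'v::finite set set" and d :: nat
  assumes "simple_hypergraph H"
    and "uniform d H"
    and "properly_connected d H"
  shows "linear_first_syzygies d (edge_ideal H :: ('v, 'k::field) mpoly set)
    \<longleftrightarrow> edge_diam d H \<le> enat d"
proof -
  let ?I = "edge_ideal H :: ('v, 'k) mpoly set"
  define c where "c = (SOME (\<phi>, a). minimal_graded_free_resolution ?I \<phi> a)"
  obtain \<phi> a where c: "c = (\<phi>, a)" by (cases c)
  have "\<exists>c. case c of (\<phi>, a) \<Rightarrow> minimal_graded_free_resolution ?I \<phi> a"
    using minimal_resolution_exists[OF assms(1)] by auto
  then have res: "minimal_graded_free_resolution ?I \<phi> a"
    using someI_ex[of "\<lambda>(\<phi>, a). minimal_graded_free_resolution ?I \<phi> a"] c by (simp add: c_def)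
  interpret P: minimal_presentation H d "dim_col (\<phi> 0)" "\<lambda>p. \<phi> 0 $$ (0, p)" "a 0"
      "dim_col (\<phi> 1)" "\<lambda>p q. \<phi> 1 $$ (p, q)" "a 1"
    by (rule minimal_presentation_of_resolution[OF res assms(2)])
  have betti: "graded_betti ?I 1 j = card {q. q < dim_col (\<phi> 1) \<and> a 1 q = j}" for j
    unfolding graded_betti_def using c by (simp add: c_def)
  have linear: "linear_first_syzygies d ?I \<longleftrightarrow> (\<forall>q<dim_col (\<phi> 1). a 1 q = d + 1)"
    unfolding linear_first_syzygies_def betti by auto
  show ?thesis
  proof
    assume "linear_first_syzygies d ?I"
    then have lin: "\<And>q. q < dim_col (\<phi> 1) \<Longrightarrow> a 1 q = d + 1" by (simp add: linear)
    have "edge_dist d H E F \<le> enat d" if EF: "E \<in> H" "F \<in> H" for E F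
    proof (cases "E \<inter> F = {}")
      case True
      have "E \<noteq> {}" using assms(1) EF(1) by (auto simp: simple_hypergraph_def)
      then have "E \<noteq> F" using True by blast
      then obtain G v where "G \<in> H" "G \<noteq> E" "v \<in> F" "G \<subseteq> insert v E"
        using P.linear_imp_neighbour[OF lin EF True] by blast
      then show ?thesis using edge_dist_disjoint_le[OF assms EF _ True] by blast
    next
      case False
      then show ?thesis using assms(3) EF by (simp add: properly_connected_def)
    qed
    then show "edge_diam d H \<le> enat d" by (simp add: edge_diam_le_iff)
  next
    assume diam: "edge_diam d H \<le> enat d"
    have links: "\<exists>Es. Es \<noteq> [] \<and> hd Es = E \<and> last Es = F \<and> set Es \<subseteq> H \<and>
      \<Union> (set Es) \<subseteq> E \<union> F \<and> successively (\<lambda>G G'. card (G \<inter> G') = d - 1) Es" if "E \<in> H" "F \<in> H" for E F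
      using proper_chain_within_union[OF assms(2,3) diam that] by metis
    have "a 1 q = d + 1" if "q < dim_col (\<phi> 1)" for q
      by (rule P.linked_imp_linear[OF links that])
    then show "linear_first_syzygies d ?I" by (simp add: linear)
  qed
qed

end
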